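(* Let $\Gamma=\{\phi=0\}\subset\mathbb{R}^2$ be a closed $C^2$ curve, where $\phi$ is $C^2$ and $|\nabla\phi|\ge c_0>0$ on $\Gamma$. For grid size $h$, let $\Delta_h^{red}=\Delta_hE_h$ be the reduced discrete Laplace–Beltrami operator on the primary cut points, as defined in the context. Then there exist constants $K$ and $h_0>0$, depending on the curve, such that for all $0<h\le h_0$ and all $k>0$ with $$\frac{k}{h^2}\ \ge\ \frac12+Kh,$$ the matrix $I-k\Delta_h^{red}$ is invertible, and all entries of the inverse $(I-k\Delta_h^{red})^{-1}$ are nonnegative.
   Context: Grid and cut points: the grid points are $(ih,jh)$, $i,j\in\mathbb{Z}$. Each is labeled inside or outside $\Gamma$ according to the sign of $\phi$ (arbitrarily if $\phi=0$ there). A grid interval in direction $\nu\in\{1,2\}$ is a closed segment joining two adjacent grid points that differ only in the $\nu$-th coordinate. The unit normal is $\mathbf n=(n_1,n_2)=\pm\nabla\phi/|\nabla\phi|$. Fix $0<\eta<1/\sqrt2$. The set $\Gamma_\nu$ consists of the cut points in direction $\nu$, that is, the points of $\Gamma$ with $|n_\nu|\ge\eta$ lying on grid intervals in direction $\nu$ having one endpoint inside and one outside (for small $h$, at most one per interval). So points of $\Gamma_1$ have the form $(x,jh)$ and points of $\Gamma_2$ have the form $(ih,y)$. A cut point that is itself a grid point is a single point, assigned to a $\Gamma_\nu$ with $|n_\nu|$ largest (its value is also used if it is needed as a neighbor for the other set). Primary and secondary points: each cut point is assigned to its closest grid point (ties arbitrary). Among the cut points assigned to a given grid point, the one closest to it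 (ties arbitrary) is primary and any others are secondary; each secondary point has as its associated primary point the primary point with the same grid point. Let $n_p$ and $n_s$ be the numbers of primary and secondary points. For $h$ small, near a primary point of $\Gamma_2$ the curve is a graph $y=y(x)$ with $|y_x|\le 1+O(h)$, and the neighbors of the primary point $\mathbf p=(ih,y(ih))$ are the cut points $\mathbf q^{\pm}=((i\pm1)h,\,y((i\pm1)h))\in\Gamma_2$ on this graph (each may be primary or secondary). The same holds for $\Gamma_1$ with the roles of $x$ and $y$ exchanged. Equilibration $E_h$: given a vector $u^p\in\mathbb{R}^{n_p}$ of values at primary points, the values $u^s\in\mathbb{R}^{n_s}$ at the secondary points are determined by requiring one equation for each secondary point $\mathbf s$. If $\mathbf s=((i+\theta)h,jh)\in\Gamma_1$ has closest grid point $(ih,jh)$, $|\theta|\le\frac12$, and associated primary point $\mathbf p=(ih,y(ih))\in\Gamma_2$ with neighbors $\mathbf q^\pm$, the equation is $$u(\mathbf s)=\tfrac12(-\theta+\theta^2)\,u(\mathbf q^-)+(1-\theta^2)\,u(\mathbf p)+\tfrac12(\theta+\theta^2)\,u(\mathbf q^+),$$ and similarly with the roles of the coordinates exchanged. This linear system has the form $u^s=\Pi_{sp}u^p+\Pi_{ss}u^s$, where $I-\Pi_{ss}$ is strictly diagonally dominant, so $u^s=(I-\Pi_{ss})^{-1}\Pi_{sp}u^p$. Define the $(n_p+n_s)\times n_p$ matrix $E_h$ by $E_hu^p=(u^p\ u^s)^T$. Discrete Laplace–Beltrami operator $\Delta_h$: the Laplace–Beltrami operator on the curve is $\Delta u=c\,\frac{d}{d\xi}\big(c\,\frac{du}{d\xi}\big)$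 with $c=|d\mathbf X/d\xi|^{-1}$, $\mathbf X=(x,y)$ (the second arclength derivative). $\Delta_h$ is the $n_p\times(n_p+n_s)$ matrix which, at a primary point $(ih,y(ih))\in\Gamma_2$ (coordinate $\xi=x$), is $$\Delta_hu_i=\big(c_{i+1}u_{i+1}+c_{i-1}u_{i-1}-2c_iu_i\big)/h^2,\qquad 2c_i=c_{i+1}+c_{i-1},$$ where $u_i=u(\mathbf p)$, $u_{i\pm1}=u(\mathbf q^\pm)$, and $c_{i\pm1}=c(ih)\,\frac{c((i\pm1)h)+c(ih)}{2}$ with $c(x)=(1+y_x(x)^2)^{-1/2}$. These coefficients approximate $1/(1+y_x^2)$, and $c_i\ge\frac12-O(h)$, $c_{i\pm1}-c_i=O(h)$ uniformly. At primary points of $\Gamma_1$ the definition is the same with the roles of $x$ and $y$ exchanged. The reduced operator is the $n_p\times n_p$ matrix $\Delta_h^{red}=\Delta_hE_h$. *)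

theory Defs
  imports "HOL-Analysis.Analysis" "Jordan_Normal_Form.Gauss_Jordan_Elimination"
begin

(* Points of the plane are vectors of type real^2, written with the vec_nth notation;
   matrices of varying size are those of Jordan_Normal_Form. *)
no_notation vec_index (infixl \<open>$\<close> 100)

section \<open>The curve\<close>

definition C2_function :: "(real^2 \<Rightarrow> real) \<Rightarrow> bool" where
  "C2_function \<phi> \<longleftrightarrow>
     (\<exists>(G :: real^2 \<Rightarrow> real^2) (H :: real^2 \<Rightarrow> real^2^2).
        (\<forall>x. GDERIV \<phi> x :> G x) \<and>
        (\<forall>x. (G has_derivative (\<lambda>v. H x *v v)) (at x)) \<and>
        continuous_on UNIV H)"

definition closed_C2_curve :: "(real^2) set \<Rightarrow> bool" where
  "closed_C2_curve S \<longleftrightarrow>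
     (\<exists>X X' X'' :: real \<Rightarrow> real^2.
        (\<forall>t. (X has_vector_derivative X' t) (at t)) \<and>
        (\<forall>t. (X' has_vector_derivative X'' t) (at t)) \<and>
        continuous_on UNIV X'' \<and>
        (\<forall>t. X' t \<noteq> 0) \<and>
        (\<forall>t. X (t + 1) = X t) \<and> inj_on X {0..<1} \<and>
        S = range X)"

definition grad :: "(real^2 \<Rightarrow> real) \<Rightarrow> real^2 \<Rightarrow> real^2" where
  "grad \<phi> x = (THE D. GDERIV \<phi> x :> D)"

definition unit_normal :: "(real^2 \<Rightarrow> real) \<Rightarrow> real^2 \<Rightarrow> real^2" where
  "unit_normal \<phi> x = grad \<phi> x /\<^sub>R norm (grad \<phi> x)"

section \<open>Grid and cut points\<close>

definition grid :: "real \<Rightarrow> (real^2) set" where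
  "grid h = {g. \<forall>\<nu>. \<exists>i::int. g $ \<nu> = of_int i * h}"

text \<open>
  The predicate \<open>ins\<close> marks the grid points labeled as inside, and \<open>\<phi> < 0\<close> is taken to be
  the inside. Grid points with \<open>\<phi> = 0\<close> may carry either label.
\<close>

definition labeling :: "(real^2 \<Rightarrow> real) \<Rightarrow> real \<Rightarrow> (real^2 \<Rightarrow> bool) \<Rightarrow> bool" where
  "labeling \<phi> h ins \<longleftrightarrow>
     (\<forall>g\<in>grid h. (\<phi> g < 0 \<longrightarrow> ins g) \<and> (\<phi> g > 0 \<longrightarrow> \<not> ins g))"

text \<open>
  A grid point on the curve can lie in \<open>cuts_in_dir \<dots> \<nu>\<close> for both \<open>\<nu>\<close>. It is nevertheless
  one element of \<open>cuts\<close>; its direction is fixed by \<open>dir\<close> in the locale below.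
\<close>

definition cuts_in_dir ::
    "(real^2 \<Rightarrow> real) \<Rightarrow> real \<Rightarrow> real \<Rightarrow> (real^2 \<Rightarrow> bool) \<Rightarrow> 2 \<Rightarrow> (real^2) set" where
  "cuts_in_dir \<phi> \<eta> h ins \<nu> =
     {p. \<phi> p = 0 \<and> \<eta> \<le> \<bar>unit_normal \<phi> p $ \<nu>\<bar> \<and>
         (\<exists>g\<in>grid h. p \<in> closed_segment g (g + h *\<^sub>R axis \<nu> 1) \<and>
                     ins g \<noteq> ins (g + h *\<^sub>R axis \<nu> 1))}"

definition cuts :: "(real^2 \<Rightarrow> real) \<Rightarrow> real \<Rightarrow> real \<Rightarrow> (real^2 \<Rightarrow> bool) \<Rightarrow> (real^2) set" where
  "cuts \<phi> \<eta> h ins = (\<Union>\<nu>. cuts_in_dir \<phi> \<eta> h ins \<nu>)"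

section \<open>The curve as a graph near a cut point\<close>

definition other_dir :: "2 \<Rightarrow> 2" where
  "other_dir \<nu> = (if \<nu> = 1 then 2 else 1)"

text \<open>
  With \<open>\<mu> = 2\<close> this is the point \<open>(t, y t)\<close>, with \<open>\<mu> = 1\<close> it is \<open>(y t, t)\<close>.
\<close>

definition graph_point :: "2 \<Rightarrow> (real \<Rightarrow> real) \<Rightarrow> real \<Rightarrow> real^2" where
  "graph_point \<mu> y t = (\<chi> \<kappa>. if \<kappa> = \<mu> then y t else t)"

text \<open>
  The function whose graph is the curve near \<open>p\<close>. The open interval of half-width \<open>2 * h\<close>
  contains the parameters of \<open>p\<close> and of its two neighbors, so that the two-sided derivative
  is meaningful at all three; only the values and derivatives there are used. For a primary
  point and small \<open>h\<close> there is exactly one such function on this interval.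
\<close>

definition local_graph :: "(real^2 \<Rightarrow> real) \<Rightarrow> real \<Rightarrow> 2 \<Rightarrow> real^2 \<Rightarrow> real \<Rightarrow> real" where
  "local_graph \<phi> h \<mu> p =
     (SOME y. y (p $ other_dir \<mu>) = p $ \<mu> \<and>
              (\<forall>t. \<bar>t - p $ other_dir \<mu>\<bar> < 2 * h \<longrightarrow>
                   y differentiable (at t) \<and> \<phi> (graph_point \<mu> y t) = 0))"

section \<open>The discrete operators\<close>

definition mat_inv :: "real mat \<Rightarrow> real mat" where
  "mat_inv A = the (mat_inverse A)"

text \<open>
  The parameters collect all arbitrary choices: the labels \<open>ins\<close>, the direction \<open>dir p\<close> of
  the set to which the cut point \<open>p\<close> is assigned (a genuine choice only for grid points with
  normal components of equal size), the closest grid point \<open>near p\<close>, the primary point \<open>prim g\<close>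
  of the grid point \<open>g\<close>, and enumerations \<open>ps\<close> and \<open>ss\<close> of the primary and the secondary points.
\<close>

locale cut_points =
  fixes \<phi> :: "real^2 \<Rightarrow> real" and \<eta> h :: real
    and ins :: "real^2 \<Rightarrow> bool" and dir :: "real^2 \<Rightarrow> 2"
    and near prim :: "real^2 \<Rightarrow> real^2" and ps ss :: "(real^2) list"
  assumes labels: "labeling \<phi> h ins"
    and dir: "\<forall>p\<in>cuts \<phi> \<eta> h ins. p \<in> cuts_in_dir \<phi> \<eta> h ins (dir p) \<and>
               (\<forall>\<nu>. p \<in> cuts_in_dir \<phi> \<eta> h ins \<nu> \<longrightarrow>
                    \<bar>unit_normal \<phi> p $ \<nu>\<bar> \<le> \<bar>unit_normal \<phi> p $ dir p\<bar>)"
    and near: "\<forall>p\<in>cuts \<phi> \<eta> h ins. near p \<in> grid h \<and>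
               (\<forall>g\<in>grid h. dist p (near p) \<le> dist p g)"
    and prim: "\<forall>g\<in>near ` cuts \<phi> \<eta> h ins.
               prim g \<in> cuts \<phi> \<eta> h ins \<and> near (prim g) = g \<and>
               (\<forall>q\<in>cuts \<phi> \<eta> h ins. near q = g \<longrightarrow> dist (prim g) g \<le> dist q g)"
    and primary: "distinct ps" "set ps = prim ` near ` cuts \<phi> \<eta> h ins"
    and secondary: "distinct ss" "set ss = cuts \<phi> \<eta> h ins - set ps"
begin

definition graph_fun :: "real^2 \<Rightarrow> real \<Rightarrow> real" where
  "graph_fun p = local_graph \<phi> h (dir p) p"

text \<open>The coordinate of \<open>p\<close> serving as parameter \<open>\<xi>\<close> of the graph through \<open>p\<close>.\<close>

definition param :: "real^2 \<Rightarrow> real" where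
  "param p = p $ other_dir (dir p)"

text \<open>The neighbors \<open>q\<^sup>+\<close> and \<open>q\<^sup>-\<close> are \<open>nbr p 1\<close> and \<open>nbr p (- 1)\<close>.\<close>

definition nbr :: "real^2 \<Rightarrow> real \<Rightarrow> real^2" where
  "nbr p \<sigma> = graph_point (dir p) (graph_fun p) (param p + \<sigma> * h)"

definition theta :: "real^2 \<Rightarrow> real" where
  "theta s = (s $ dir s - near s $ dir s) / h"

text \<open>
  The coefficient of the unknown \<open>u a\<close> on the right-hand side of the equilibration equation
  of the secondary point \<open>s\<close>.
\<close>

definition equil_coeff :: "real^2 \<Rightarrow> real^2 \<Rightarrow> real" where
  "equil_coeff s a =
     (let \<theta> = theta s; p = prim (near s) in
        (- \<theta> + \<theta>\<^sup>2) / 2 * of_bool (a = nbr p (- 1))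
      + (1 - \<theta>\<^sup>2) * of_bool (a = p)
      + (\<theta> + \<theta>\<^sup>2) / 2 * of_bool (a = nbr p 1))"

definition Pi_sp :: "real mat" where
  "Pi_sp = mat (length ss) (length ps) (\<lambda>(i, j). equil_coeff (ss ! i) (ps ! j))"

definition Pi_ss :: "real mat" where
  "Pi_ss = mat (length ss) (length ss) (\<lambda>(i, j). equil_coeff (ss ! i) (ss ! j))"

definition E_mat :: "real mat" where
  "E_mat = 1\<^sub>m (length ps) @\<^sub>r (mat_inv (1\<^sub>m (length ss) - Pi_ss) * Pi_sp)"

definition c_fun :: "real^2 \<Rightarrow> real \<Rightarrow> real" where
  "c_fun p t = 1 / sqrt (1 + (deriv (graph_fun p) t)\<^sup>2)"

text \<open>\<open>c_nbr p 1\<close> and \<open>c_nbr p (- 1)\<close> are the coefficients with index \<open>i + 1\<close> and \<open>i - 1\<close>.\<close>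

definition c_nbr :: "real^2 \<Rightarrow> real \<Rightarrow> real" where
  "c_nbr p \<sigma> = c_fun p (param p) * ((c_fun p (param p + \<sigma> * h) + c_fun p (param p)) / 2)"

definition c_mid :: "real^2 \<Rightarrow> real" where
  "c_mid p = (c_nbr p 1 + c_nbr p (- 1)) / 2"

definition lap_coeff :: "real^2 \<Rightarrow> real^2 \<Rightarrow> real" where
  "lap_coeff p a =
     (c_nbr p 1 * of_bool (a = nbr p 1) + c_nbr p (- 1) * of_bool (a = nbr p (- 1))
      - 2 * c_mid p * of_bool (a = p)) / h\<^sup>2"

definition Lap :: "real mat" where
  "Lap = mat (length ps) (length ps + length ss)
           (\<lambda>(i, j). lap_coeff (ps ! i) ((ps @ ss) ! j))"

definition Lap_red :: "real mat" where
  "Lap_red = Lap * E_mat"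

end

end

(*
  A is shown to be monotone: A u >= 0 implies u >= 0. Extend u to the secondary points by
  equilibration. In the equation of a secondary point only one neighbor of the associated
  primary point p has a negative weight, and the Laplacian equation at p eliminates it. For
  k / h^2 >= 1/2 + K h the remaining weights are nonnegative, so a negative minimum is impossible.
  The elimination needs the coefficients at p to be at least 1/2 - O(h) and to differ by O(h).
  This holds because they are products of normal components along the graph through p, and a
  curve steeper than the diagonal at p would have a cut point closer to the grid point of p.
*)

theory Submission
  imports Defs "Jordan_Normal_Form.Determinant"
begin

(* Importing Determinant brings this notation back. *)
no_notation vec_index (infixl \<open>$\<close> 100)

text \<open>The threshold 1/2 comes from the worst case \<theta> = 1/2. After the elimination, p has
  the weight 1 - \<theta>^2 - x \<theta> (1 - \<theta>) / 2 with x = (h^2 / k + cp + cm) / cm, where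
  cp and cm belong to the neighbors with positive and negative weight. At \<theta> = 1/2 this is
  nonnegative exactly when x \<le> 6. With both coefficients equal to 1/2, their smallest size to
  leading order, this says h^2 / k \<le> 2; the term K h pays for the O(h) deviations. A cut point
  in general only has a normal component of size at least \<eta>; it is the competition for the grid
  point that improves this to about 1 / sqrt 2 at primary points. The competing point counts as a
  cut point because \<eta> < 1 / sqrt 2. Since \<open>local_graph\<close> is a choice, existence of
  a graph is not enough: every function that may be chosen has to be controlled on the whole window
  around p.\<close>

section \<open>Matrices with nonnegative inverse\<close>

text \<open>\<open>mat_inv\<close> has a meaning only where \<open>mat_inverse\<close> returns
  \<open>Some\<close>. A trivial kernel makes the determinant nonzero, hence the matrix a
  unit.\<close>

lemma mat_inv_eqs:
  assumes A: "A \<in> carrier_mat n n"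
    and inj: "\<And>v. v \<in> carrier_vec n \<Longrightarrow> A *\<^sub>v v = 0\<^sub>v n \<Longrightarrow> v = 0\<^sub>v n"
  shows "mat_inv A \<in> carrier_mat n n" "A * mat_inv A = 1\<^sub>m n" "mat_inv A * A = 1\<^sub>m n"
proof -
  have "Determinant.det A \<noteq> 0"
    using det_0_iff_vec_prod_zero[OF A] inj by blast
  then have "A \<in> Units (ring_mat TYPE(real) n ())"
    by (rule det_non_zero_imp_unit[OF A])
  then obtain B where B: "mat_inverse A = Some B"
    using mat_inverse(1)[OF A, where b = "()"] by (cases "mat_inverse A") auto
  then show "mat_inv A \<in> carrier_mat n n" "A * mat_inv A = 1\<^sub>m n" "mat_inv A * A = 1\<^sub>m n"
    using mat_inverse(2)[OF A B] by (auto simp: mat_inv_def)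
qed

text \<open>If \<open>A v = 0\<close>, monotonicity applies to both v and -v, so the kernel is
  trivial. Column j of the inverse solves \<open>A x = unit_vec n j\<close>, whose right-hand side
  is nonnegative.\<close>

lemma monotone_matrix_inverse_nonneg:
  assumes A: "A \<in> carrier_mat n n"
    and mono: "\<And>v. v \<in> carrier_vec n \<Longrightarrow> \<forall>i<n. 0 \<le> vec_index (A *\<^sub>v v) i \<Longrightarrow>
                 \<forall>i<n. 0 \<le> vec_index v i"
  shows "invertible_mat A" "\<forall>i<n. \<forall>j<n. mat_inv A $$ (i, j) \<ge> 0"
proof -
  have inj: "v = 0\<^sub>v n" if v: "v \<in> carrier_vec n" and 0: "A *\<^sub>v v = 0\<^sub>v n" for v
  proof -
    have "A *\<^sub>v (- v) = - (A *\<^sub>v v)"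
      by (intro eq_vecI) (use A v in \<open>auto simp: scalar_prod_def sum_negf\<close>)
    then have "\<forall>i<n. 0 \<le> vec_index (A *\<^sub>v (- v)) i"
      using 0 by simp
    then have "\<forall>i<n. 0 \<le> vec_index (- v) i"
      using mono[of "- v"] v by simp
    moreover have "\<forall>i<n. 0 \<le> vec_index v i"
      using mono[OF v] 0 by simp
    ultimately show ?thesis
      using v by (intro eq_vecI) force+
  qed
  note inv = mat_inv_eqs[OF A inj]
  show "invertible_mat A"
    unfolding invertible_mat_def inverts_mat_def using inv A by auto
  show "\<forall>i<n. \<forall>j<n. mat_inv A $$ (i, j) \<ge> 0"
  proof (intro allI impI)
    fix i j assume ij: "i < n" "j < n"
    have "A *\<^sub>v col (mat_inv A) j = col (A * mat_inv A) j"
      using A inv(1) ij by (simp add: col_mult2)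
    also have "\<dots> = unit_vec n j"
      using inv(2) ij by simp
    finally have "\<forall>i<n. 0 \<le> vec_index (col (mat_inv A) j) i"
      using mono[of "col (mat_inv A) j"] inv(1) ij by (simp add: col_dim)
    then show "mat_inv A $$ (i, j) \<ge> 0"
      using inv(1) ij by simp
  qed
qed

lemma smult_mat_mult_vec:
  assumes "A \<in> carrier_mat m n" "v \<in> carrier_vec n"
  shows "(k \<cdot>\<^sub>m A) *\<^sub>v v = k \<cdot>\<^sub>v (A *\<^sub>v v)"
  using assms by (intro eq_vecI) (auto simp: scalar_prod_def sum_distrib_left mult.assoc)

text \<open>A kernel vector satisfies v = P v. At an entry of largest modulus m this gives m \<le>
  (row sum) m, so m = 0.\<close>

lemma one_minus_contraction_inj:
  fixes P :: "real mat"
  assumes P: "P \<in> carrier_mat n n"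
    and rows: "\<And>i. i < n \<Longrightarrow> (\<Sum>j<n. \<bar>P $$ (i, j)\<bar>) < 1"
    and v: "v \<in> carrier_vec n" and 0: "(1\<^sub>m n - P) *\<^sub>v v = 0\<^sub>v n"
  shows "v = 0\<^sub>v n"
proof (cases "n = 0")
  case True
  then show ?thesis using v by auto
next
  case False
  define m where "m = Max ((\<lambda>j. \<bar>vec_index v j\<bar>) ` {..<n})"
  have m: "\<bar>vec_index v j\<bar> \<le> m" if "j < n" for j
    unfolding m_def using that by (intro Max_ge) auto
  have "m \<in> (\<lambda>j. \<bar>vec_index v j\<bar>) ` {..<n}"
    unfolding m_def using False by (intro Max_in) auto
  then obtain i where i: "i < n" "m = \<bar>vec_index v i\<bar>" by auto
  have "(1\<^sub>m n - P) *\<^sub>v v = v - P *\<^sub>v v"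
    using P v by (simp add: minus_mult_distrib_mat_vec[of _ n n])
  then have "vec_index (v - P *\<^sub>v v) i = vec_index (0\<^sub>v n) i" using 0 by metis
  then have "vec_index v i = (\<Sum>j<n. P $$ (i, j) * vec_index v j)"
    using P v i by (simp add: scalar_prod_def atLeast0LessThan)
  then have "m \<le> (\<Sum>j<n. \<bar>P $$ (i, j) * vec_index v j\<bar>)"
    using i(2) by (simp add: sum_abs)
  also have "\<dots> \<le> (\<Sum>j<n. \<bar>P $$ (i, j)\<bar> * m)"
    by (intro sum_mono) (simp add: abs_mult mult_left_mono m)
  finally have le: "m \<le> (\<Sum>j<n. \<bar>P $$ (i, j)\<bar>) * m"
    by (simp add: sum_distrib_right)
  have "m = 0"
  proof (rule ccontr)
    assume "m \<noteq> 0"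
    then have "m > 0" using i(2) by linarith
    then show False using le rows[OF i(1)] mult_strict_right_mono by fastforce
  qed
  then show ?thesis using m v by (intro eq_vecI) force+
qed

text \<open>
  Solving the Laplacian equation at \<open>p\<close> for \<open>u(q\<^sup>-)\<close> turns the negative weight of \<open>q\<^sup>-\<close> in the
  equilibration equation into the weights \<open>w\<close> of \<open>p\<close>, \<open>g\<close> of \<open>q\<^sup>+\<close> and \<open>d\<close> of the right-hand side;
  the bound on \<open>1 / \<kappa>\<close> is what makes \<open>w\<close> nonnegative up to \<open>\<theta> = 1/2\<close>.
\<close>

lemma equil_without_negative_weight:
  fixes \<theta> \<kappa> cp cm up uq um f us :: real
  assumes \<theta>: "0 \<le> \<theta>" "\<theta> \<le> 1/2" and \<kappa>: "\<kappa> > 0" and c: "cp > 0" "cm > 0"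
    and bound: "1 / \<kappa> + cp \<le> 5 * cm"
    and lap: "up - \<kappa> * (cp * uq + cm * um - (cp + cm) * up) = f"
    and us: "us = (- \<theta> + \<theta>\<^sup>2) / 2 * um + (1 - \<theta>\<^sup>2) * up + (\<theta> + \<theta>\<^sup>2) / 2 * uq"
  obtains w g d where "w \<ge> 0" "g \<ge> 0" "d \<ge> 0" "d = 0 \<longrightarrow> us = up" "w + g + d = 1"
    "us = w * up + g * uq + d * f"
proof
  \<comment> \<open>Here -\<alpha> is the negative weight, and the Laplacian equation solved for
    \<open>um\<close> reads \<open>um = x * up - y * uq - z * f\<close>.\<close>
  define \<alpha> where "\<alpha> = \<theta> * (1 - \<theta>) / 2"
  define x where "x = (1 / \<kappa> + cp + cm) / cm"
  define y where "y = cp / cm"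
  define z where "z = (1 / \<kappa>) / cm"
  define d where "d = \<alpha> * z"
  define g where "g = (\<theta> + \<theta>\<^sup>2) / 2 + \<alpha> * y"
  define w where "w = (1 - \<theta>\<^sup>2) - \<alpha> * x"
  have \<alpha>: "\<alpha> \<ge> 0" unfolding \<alpha>_def using \<theta> by simp
  \<comment> \<open>At the value 6 the weight of \<open>up\<close> factors as (1 - \<theta>) (1 - 2
    \<theta>), which vanishes exactly at the end \<theta> = 1/2 of the range.\<close>
  have "x \<le> 6" unfolding x_def using bound c by (simp add: field_simps)
  then have "\<alpha> * x \<le> \<alpha> * 6" using \<alpha> by (intro mult_left_mono)
  moreover have "(1 - \<theta>\<^sup>2) - \<alpha> * 6 = (1 - \<theta>) * (1 - 2 * \<theta>)"
    by (simp add: \<alpha>_def power2_eq_square field_simps)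
  moreover have "(1 - \<theta>) * (1 - 2 * \<theta>) \<ge> 0" using \<theta> by simp
  ultimately show "w \<ge> 0" by (simp add: w_def)
  show "g \<ge> 0" unfolding g_def y_def using \<alpha> c \<theta> by simp
  show "d \<ge> 0" unfolding d_def z_def using \<alpha> c \<kappa> by simp
  show "d = 0 \<longrightarrow> us = up"
  proof
    assume "d = 0"
    then have "\<theta> = 0" using c \<kappa> \<theta> by (auto simp: d_def z_def \<alpha>_def)
    then show "us = up" using us by simp
  qed
  \<comment> \<open>Constants satisfy both equations, with f equal to the same constant, so the
    weights must sum to one.\<close>
  show "w + g + d = 1" unfolding w_def g_def d_def x_def y_def z_def using c \<kappa>
    by (simp add: \<alpha>_def field_simps power2_eq_square)
  have um: "um = x * up - y * uq - z * f"
  proof -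
    have "\<kappa> * cm * um = (1 + \<kappa> * cp + \<kappa> * cm) * up - \<kappa> * cp * uq - f"
      using lap by (simp add: algebra_simps)
    then have "um = ((1 + \<kappa> * cp + \<kappa> * cm) * up - \<kappa> * cp * uq - f) / (\<kappa> * cm)"
      using c \<kappa> by (simp add: field_simps)
    also have "\<dots> = x * up - y * uq - z * f"
      unfolding x_def y_def z_def
      using c(2) \<kappa> by (simp add: field_simps)
    finally show ?thesis .
  qed
  have "us = - \<alpha> * um + (1 - \<theta>\<^sup>2) * up + (\<theta> + \<theta>\<^sup>2) / 2 * uq"
    unfolding us \<alpha>_def by (simp add: field_simps power2_eq_square)
  then show "us = w * up + g * uq + d * f"
    unfolding um w_def g_def d_def by (simp add: algebra_simps)
qed

section \<open>Monotonicity of the reduced operator\<close>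

context cut_points
begin

lemma prim_mem: "s \<in> set ss \<Longrightarrow> prim (near s) \<in> set ps"
  using primary(2) secondary(2) by auto

lemma distinct_points: "distinct (ps @ ss)"
  using primary secondary prim by auto

text \<open>Equations refer to neighbors by position in the plane, vectors by index; this translates
  between the two. A point in neither list gets the value 0.\<close>

definition nodal :: "real vec \<Rightarrow> real^2 \<Rightarrow> real" where
  "nodal w a = (\<Sum>j<length (ps @ ss). of_bool ((ps @ ss) ! j = a) * vec_index w j)"

lemma nodal_nth: "i < length (ps @ ss) \<Longrightarrow> nodal w ((ps @ ss) ! i) = vec_index w i"
proof -
  assume i: "i < length (ps @ ss)"
  have "nodal w ((ps @ ss) ! i) = (\<Sum>j<length (ps @ ss). if j = i then vec_index w j else 0)"
    unfolding nodal_def using distinct_points i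
    by (intro sum.cong) (auto simp: nth_eq_iff_index_eq simp del: distinct_append length_append)
  then show ?thesis using i by simp
qed

lemma nodal_outside: "a \<notin> set (ps @ ss) \<Longrightarrow> nodal w a = 0"
  unfolding nodal_def by (intro sum.neutral) (metis lessThan_iff nth_mem mult_eq_0_iff of_bool_eq_0_iff)

text \<open>The associated point is primary, so its weight 1 - \<theta>^2 belongs to
  \<open>Pi_sp\<close>. The moduli of the two remaining weights add up to |\<theta>| \<le>
  1/2.\<close>

lemma Pi_ss_row_sum:
  assumes \<theta>: "\<forall>s\<in>set ss. \<bar>theta s\<bar> \<le> 1/2" and i: "i < length ss"
  shows "(\<Sum>j<length ss. \<bar>Pi_ss $$ (i, j)\<bar>) < 1"
proof -
  define s where "s = ss ! i"
  have s: "s \<in> set ss" using i s_def by simp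
  define \<theta> where "\<theta> = theta s"
  define a where "a = \<bar>(- \<theta> + \<theta>\<^sup>2) / 2\<bar>"
  define b where "b = \<bar>(\<theta> + \<theta>\<^sup>2) / 2\<bar>"
  have count: "(\<Sum>j<length ss. of_bool (ss ! j = q)) \<le> (1::real)" for q
  proof (cases "q \<in> set ss")
    case True
    then obtain l where l: "l < length ss" "ss ! l = q" by (auto simp: in_set_conv_nth)
    then have "(\<Sum>j<length ss. of_bool (ss ! j = q)) = (\<Sum>j<length ss. if j = l then 1 else (0::real))"
      using secondary(1) by (intro sum.cong) (auto simp: nth_eq_iff_index_eq)
    then show ?thesis using l by simp
  next
    case False
    then have "(\<Sum>j<length ss. of_bool (ss ! j = q)) = (0::real)"
      by (intro sum.neutral) (auto simp: in_set_conv_nth)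
    then show ?thesis by simp
  qed
  have row: "\<bar>Pi_ss $$ (i, j)\<bar> \<le> a * of_bool (ss ! j = nbr (prim (near s)) (- 1))
      + b * of_bool (ss ! j = nbr (prim (near s)) 1)" if j: "j < length ss" for j
  proof -
    have "ss ! j \<in> set ss" using j by simp
    then have "ss ! j \<noteq> prim (near s)"
      using prim_mem[OF s] distinct_points by auto
    then have "Pi_ss $$ (i, j) = (- \<theta> + \<theta>\<^sup>2) / 2 * of_bool (ss ! j = nbr (prim (near s)) (- 1))
      + (\<theta> + \<theta>\<^sup>2) / 2 * of_bool (ss ! j = nbr (prim (near s)) 1)"
      using i j by (simp add: Pi_ss_def equil_coeff_def Let_def \<theta>_def s_def)
    then show ?thesis
      unfolding a_def b_def
      by (simp only:) (rule order_trans[OF abs_triangle_ineq], simp add: abs_mult)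
  qed
  have "(\<Sum>j<length ss. \<bar>Pi_ss $$ (i, j)\<bar>) \<le>
      (\<Sum>j<length ss. a * of_bool (ss ! j = nbr (prim (near s)) (- 1))
      + b * of_bool (ss ! j = nbr (prim (near s)) 1))"
    by (intro sum_mono row) simp
  also have "\<dots> = a * (\<Sum>j<length ss. of_bool (ss ! j = nbr (prim (near s)) (- 1)))
      + b * (\<Sum>j<length ss. of_bool (ss ! j = nbr (prim (near s)) 1))"
    by (simp only: sum.distrib sum_distrib_left)
  also have "\<dots> \<le> a * 1 + b * 1"
    by (intro add_mono mult_left_mono count) (auto simp: a_def b_def)
  also have "\<dots> < 1"
  proof -
    have "\<bar>\<theta>\<bar> \<le> 1/2" using \<theta> s by (simp add: \<theta>_def)
    moreover from this have "\<theta>\<^sup>2 \<le> (1/2)\<^sup>2" by (intro abs_le_square_iff[THEN iffD1]) simp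
    then have "\<theta>\<^sup>2 \<le> 1/4" by (simp add: power2_eq_square)
    moreover have "\<bar>(- x + q) / 2\<bar> * 1 + \<bar>(x + q) / 2\<bar> * 1 < 1"
      if "\<bar>x\<bar> \<le> 1/2" "0 \<le> q" "q \<le> 1/4" for x q :: real
      using that by (auto simp: abs_if field_simps)
    ultimately show ?thesis unfolding a_def b_def by simp
  qed
  finally show ?thesis .
qed

text \<open>Applying \<open>I - Pi_ss\<close> to the lower block of \<open>E_mat\<close> cancels the
  inverse. The sums from \<open>Pi_sp\<close> and \<open>Pi_ss\<close> then merge into one sum over
  \<open>ps @ ss\<close>, which is the equilibration equation in terms of points.\<close>

lemma E_mat_solves:
  assumes \<theta>: "\<forall>s\<in>set ss. \<bar>theta s\<bar> \<le> 1/2" and u: "u \<in> carrier_vec (length ps)"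
  shows "E_mat \<in> carrier_mat (length ps + length ss) (length ps)"
    and "\<And>i. i < length ps \<Longrightarrow> nodal (E_mat *\<^sub>v u) (ps ! i) = vec_index u i"
    and "\<And>s. s \<in> set ss \<Longrightarrow> nodal (E_mat *\<^sub>v u) s =
       (- theta s + (theta s)\<^sup>2) / 2 * nodal (E_mat *\<^sub>v u) (nbr (prim (near s)) (- 1))
       + (1 - (theta s)\<^sup>2) * nodal (E_mat *\<^sub>v u) (prim (near s))
       + (theta s + (theta s)\<^sup>2) / 2 * nodal (E_mat *\<^sub>v u) (nbr (prim (near s)) 1)"
proof -
  define np where "np = length ps"
  define ns where "ns = length ss"
  have car: "Pi_ss \<in> carrier_mat ns ns" "Pi_sp \<in> carrier_mat ns np"
    by (auto simp: Pi_ss_def Pi_sp_def np_def ns_def)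
  define B where "B = mat_inv (1\<^sub>m ns - Pi_ss)"
  have C: "1\<^sub>m ns - Pi_ss \<in> carrier_mat ns ns" using car by auto
  have B: "B \<in> carrier_mat ns ns" "(1\<^sub>m ns - Pi_ss) * B = 1\<^sub>m ns"
    unfolding B_def using mat_inv_eqs[OF C]
      one_minus_contraction_inj[OF car(1)] Pi_ss_row_sum[OF \<theta>] ns_def by blast+
  have E: "E_mat = 1\<^sub>m np @\<^sub>r (B * Pi_sp)"
    by (simp add: E_mat_def B_def np_def ns_def)
  then show car_E: "E_mat \<in> carrier_mat (length ps + length ss) (length ps)"
    using B car by (auto simp flip: np_def ns_def)
  define v where "v = (B * Pi_sp) *\<^sub>v u"
  have u': "u \<in> carrier_vec np" using u np_def by simp
  have v: "v \<in> carrier_vec ns" unfolding v_def using B car u' by (intro mult_mat_vec_carrier mult_carrier_mat)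
  have Eu: "E_mat *\<^sub>v u = u @\<^sub>v v"
    unfolding E v_def using mat_mult_append[of "1\<^sub>m np" np np "B * Pi_sp" ns u] B car u' by simp
  show "nodal (E_mat *\<^sub>v u) (ps ! i) = vec_index u i" if "i < length ps" for i
    using nodal_nth[of i "E_mat *\<^sub>v u"] that u v unfolding Eu by (simp add: nth_append)
  have "(1\<^sub>m ns - Pi_ss) *\<^sub>v v = ((1\<^sub>m ns - Pi_ss) * (B * Pi_sp)) *\<^sub>v u"
    unfolding v_def using B car u' by (intro assoc_mult_mat_vec[symmetric]) auto
  also have "(1\<^sub>m ns - Pi_ss) * (B * Pi_sp) = Pi_sp"
    using assoc_mult_mat[OF C B(1) car(2)] B(2) car by simp
  finally have eq: "v - Pi_ss *\<^sub>v v = Pi_sp *\<^sub>v u"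
    using car v by (simp add: minus_mult_distrib_mat_vec[of _ ns ns])
  fix s assume s: "s \<in> set ss"
  then obtain i where i: "i < ns" "s = ss ! i" by (auto simp: in_set_conv_nth ns_def)
  have vi: "vec_index v i = (\<Sum>j<np. equil_coeff s (ps ! j) * vec_index u j)
      + (\<Sum>j<ns. equil_coeff s (ss ! j) * vec_index v j)"
    using arg_cong[OF eq, of "\<lambda>x. vec_index x i"] i car u' v
    by (simp add: scalar_prod_def atLeast0LessThan Pi_ss_def Pi_sp_def flip: np_def ns_def)
  have "(\<Sum>j<length (ps @ ss). equil_coeff s ((ps @ ss) ! j) * vec_index (u @\<^sub>v v) j)
     = (\<Sum>j<np. equil_coeff s (ps ! j) * vec_index u j)
      + (\<Sum>j<ns. equil_coeff s (ss ! j) * vec_index v j)"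
  proof -
    have "(\<Sum>j<np + ns. equil_coeff s ((ps @ ss) ! j) * vec_index (u @\<^sub>v v) j)
      = (\<Sum>j<np. equil_coeff s ((ps @ ss) ! j) * vec_index (u @\<^sub>v v) j)
        + (\<Sum>j<ns. equil_coeff s ((ps @ ss) ! (np + j)) * vec_index (u @\<^sub>v v) (np + j))"
      by (induction ns) (simp_all add: add.assoc)
    also have "\<dots> = (\<Sum>j<np. equil_coeff s (ps ! j) * vec_index u j)
      + (\<Sum>j<ns. equil_coeff s (ss ! j) * vec_index v j)"
      using u' v by (intro arg_cong2[of _ _ _ _ "(+)"] sum.cong) (auto simp: nth_append np_def)
    finally show ?thesis by (simp add: np_def ns_def)
  qed
  moreover have "nodal (u @\<^sub>v v) s = vec_index v i"
    using nodal_nth[of "np + i" "u @\<^sub>v v"] i u' v by (simp add: nth_append np_def ns_def)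
  ultimately have "nodal (u @\<^sub>v v) s =
      (\<Sum>j<length (ps @ ss). equil_coeff s ((ps @ ss) ! j) * vec_index (u @\<^sub>v v) j)"
    using vi by simp
  then show "nodal (E_mat *\<^sub>v u) s =
       (- theta s + (theta s)\<^sup>2) / 2 * nodal (E_mat *\<^sub>v u) (nbr (prim (near s)) (- 1))
       + (1 - (theta s)\<^sup>2) * nodal (E_mat *\<^sub>v u) (prim (near s))
       + (theta s + (theta s)\<^sup>2) / 2 * nodal (E_mat *\<^sub>v u) (nbr (prim (near s)) 1)"
    unfolding Eu nodal_def sum_distrib_left sum.distrib[symmetric]
    by (simp add: equil_coeff_def Let_def algebra_simps)
qed

lemma Lap_mult:
  assumes w: "w \<in> carrier_vec (length ps + length ss)" and i: "i < length ps"
  defines "p \<equiv> ps ! i"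
  shows "vec_index (Lap *\<^sub>v w) i = (c_nbr p 1 * nodal w (nbr p 1)
     + c_nbr p (- 1) * nodal w (nbr p (- 1)) - (c_nbr p 1 + c_nbr p (- 1)) * nodal w p) / h\<^sup>2"
proof -
  have mid: "2 * c_mid p = c_nbr p 1 + c_nbr p (- 1)" by (simp add: c_mid_def)
  have "vec_index (Lap *\<^sub>v w) i = (\<Sum>j<length (ps @ ss). lap_coeff p ((ps @ ss) ! j) * vec_index w j)"
    using w i by (simp add: Lap_def scalar_prod_def atLeast0LessThan p_def)
  also have "\<dots> = (c_nbr p 1 * nodal w (nbr p 1)
     + c_nbr p (- 1) * nodal w (nbr p (- 1)) - (c_nbr p 1 + c_nbr p (- 1)) * nodal w p) / h\<^sup>2"
    unfolding nodal_def sum_distrib_left sum.distrib[symmetric] sum_subtractf[symmetric] sum_divide_distrib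
    by (intro sum.cong)
      (simp_all add: lap_coeff_def mid algebra_simps add_divide_distrib diff_divide_distrib)
  finally show ?thesis .
qed

text \<open>The discrete minimum principle, with the demands on the geometry isolated in
  \<open>pos\<close> and \<open>ratio\<close>. The latter is required for both signs because the
  sign of \<open>theta s\<close> decides which neighbor has the negative weight.\<close>

lemma reduced_operator_inverse_nonneg:
  assumes k: "k > 0" and h: "h > 0"
    and \<theta>: "\<forall>s\<in>set ss. \<bar>theta s\<bar> \<le> 1/2"
    and pos: "\<And>p \<sigma>. p \<in> set ps \<Longrightarrow> \<bar>\<sigma>\<bar> = 1 \<Longrightarrow> c_nbr p \<sigma> > 0"
    and ratio: "\<And>p \<sigma>. p \<in> set ps \<Longrightarrow> \<bar>\<sigma>\<bar> = 1 \<Longrightarrow> h\<^sup>2 / k + c_nbr p \<sigma> \<le> 5 * c_nbr p (- \<sigma>)"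
  defines "A \<equiv> 1\<^sub>m (length ps) - k \<cdot>\<^sub>m Lap_red"
  shows "invertible_mat A" "\<forall>i<length ps. \<forall>j<length ps. mat_inv A $$ (i, j) \<ge> 0"
proof -
  define n where "n = length ps"
  have E: "E_mat \<in> carrier_mat (n + length ss) n"
    using E_mat_solves(1)[OF \<theta>, of "0\<^sub>v n"] by (simp add: n_def)
  have Lap: "Lap \<in> carrier_mat n (n + length ss)" by (simp add: Lap_def n_def)
  have A: "A \<in> carrier_mat n n" unfolding A_def Lap_red_def using E Lap n_def by auto
  have mono: "\<forall>i<n. 0 \<le> vec_index u i"
    if u: "u \<in> carrier_vec n" and Au: "\<forall>i<n. 0 \<le> vec_index (A *\<^sub>v u) i" for u
  proof (rule ccontr)
    assume neg: "\<not> (\<forall>i<n. 0 \<le> vec_index u i)"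
    define w where "w = E_mat *\<^sub>v u"
    have w: "w \<in> carrier_vec (n + length ss)" unfolding w_def using E u by (rule mult_mat_vec_carrier)
    define W where "W = nodal w"
    note sol = E_mat_solves[OF \<theta> u[unfolded n_def], folded w_def W_def]
    have lap: "W p - k / h\<^sup>2 * (c_nbr p \<sigma> * W (nbr p \<sigma>) + c_nbr p (- \<sigma>) * W (nbr p (- \<sigma>))
        - (c_nbr p \<sigma> + c_nbr p (- \<sigma>)) * W p) = vec_index (A *\<^sub>v u) i"
      if "i < n" "p = ps ! i" "\<bar>\<sigma>\<bar> = 1" for i p \<sigma>
    proof -
      have "A *\<^sub>v u = u - k \<cdot>\<^sub>v (Lap *\<^sub>v w)"
        using minus_mult_distrib_mat_vec[of "1\<^sub>m n" n n "k \<cdot>\<^sub>m (Lap * E_mat)" u]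
          smult_mat_mult_vec[of "Lap * E_mat" n n u k] assoc_mult_mat_vec[OF Lap E u] u E Lap
        by (simp add: A_def Lap_red_def w_def flip: n_def)
      then have "vec_index (A *\<^sub>v u) i = vec_index u i - k * vec_index (Lap *\<^sub>v w) i"
        using that(1) Lap u w by simp
      moreover have "\<sigma> = 1 \<or> \<sigma> = - 1" using that(3) by auto
      ultimately show ?thesis
        using Lap_mult[OF w[unfolded n_def], of i] that(1,2) sol(2)[of i]
        by (auto simp: W_def n_def add.commute)
    qed
    define m where "m = Min (W ` set (ps @ ss))"
    obtain i where i: "i < n" "vec_index u i < 0" using neg by force
    then have ps: "ps ! i \<in> set ps" "W (ps ! i) < 0" using sol(2)[of i] by (auto simp: n_def)
    then have "m \<le> W (ps ! i)" unfolding m_def by (intro Min_le) auto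
    then have m0: "m < 0" using ps by simp
    \<comment> \<open>Neighbors may be secondary, so the minimum runs over both lists. A point
      outside them has the value 0, which exceeds \<open>m\<close> because \<open>m\<close> is
      negative.\<close>
    have m_le: "m \<le> W a" for a
    proof (cases "a \<in> set (ps @ ss)")
      case True
      then show ?thesis unfolding m_def by (intro Min_le) auto
    next
      case False
      then show ?thesis using nodal_outside[of a w] m0 by (simp add: W_def)
    qed
    \<comment> \<open>At a primary minimum the Laplacian is nonnegative, so the right-hand side is
      at most m < 0.\<close>
    have primary_min: False if p: "p \<in> set ps" "W p = m" for p
    proof -
      obtain j where j: "j < n" "p = ps ! j" using p by (auto simp: in_set_conv_nth n_def)
      define a where "a = k / h\<^sup>2 * c_nbr p 1"
      define b where "b = k / h\<^sup>2 * c_nbr p (- 1)"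
      have ab: "a > 0" "b > 0" unfolding a_def b_def using pos[OF p(1)] k h by auto
      have "0 \<le> m - (a * W (nbr p 1) + b * W (nbr p (- 1)) - (a + b) * m)"
        using lap[OF j, of 1] Au j(1) p(2) by (simp add: a_def b_def algebra_simps)
      moreover have "a * m \<le> a * W (nbr p 1)" "b * m \<le> b * W (nbr p (- 1))"
        using ab m_le by auto
      ultimately show False using m0 by (simp add: algebra_simps)
    qed
    have "m \<in> W ` set (ps @ ss)" unfolding m_def using ps by (intro Min_in) auto
    then obtain s where s: "s \<in> set (ps @ ss)" "W s = m" by auto
    then have "s \<in> set ss" using primary_min by auto
    define p where "p = prim (near s)"
    have p: "p \<in> set ps" unfolding p_def using prim_mem \<open>s \<in> set ss\<close> .
    then obtain j where j: "j < n" "p = ps ! j" by (auto simp: in_set_conv_nth n_def)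
    \<comment> \<open>Mirroring \<theta> exchanges the two neighbors, so with |\<theta>| the
      negative weight always sits at \<open>nbr p (- \<sigma>)\<close>.\<close>
    define \<sigma> :: real where "\<sigma> = (if theta s \<ge> 0 then 1 else - 1)"
    have \<sigma>: "\<bar>\<sigma>\<bar> = 1" by (simp add: \<sigma>_def)
    have "W s = (- \<bar>theta s\<bar> + \<bar>theta s\<bar>\<^sup>2) / 2 * W (nbr p (- \<sigma>))
       + (1 - \<bar>theta s\<bar>\<^sup>2) * W p + (\<bar>theta s\<bar> + \<bar>theta s\<bar>\<^sup>2) / 2 * W (nbr p \<sigma>)"
      using sol(3)[OF \<open>s \<in> set ss\<close>] by (simp add: \<sigma>_def p_def)
    moreover have "1 / (k / h\<^sup>2) + c_nbr p \<sigma> \<le> 5 * c_nbr p (- \<sigma>)" using ratio[OF p \<sigma>] by simp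
    moreover have "0 \<le> \<bar>theta s\<bar>" "\<bar>theta s\<bar> \<le> 1/2" "k / h\<^sup>2 > 0" "c_nbr p \<sigma> > 0" "c_nbr p (- \<sigma>) > 0"
      using \<theta> \<open>s \<in> set ss\<close> k h pos[OF p] \<sigma> by simp_all
    ultimately obtain a g d where agd: "a \<ge> 0" "g \<ge> 0" "d \<ge> 0" "d = 0 \<longrightarrow> W s = W p" "a + g + d = 1"
      "W s = a * W p + g * W (nbr p \<sigma>) + d * vec_index (A *\<^sub>v u) j"
      using equil_without_negative_weight[OF _ _ _ _ _ _ lap[OF j \<sigma>]] by blast
    have "a * m \<le> a * W p" "g * m \<le> g * W (nbr p \<sigma>)" "0 \<le> d * vec_index (A *\<^sub>v u) j"
      using agd m_le Au j(1) by (auto intro: mult_left_mono)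
    \<comment> \<open>As a + g = 1 - d, this leaves 0 \<le> d m and hence d = 0. Then s and p share
      the value m, and the minimum is primary after all.\<close>
    then have "(a + g) * m \<le> m" using agd(6) s(2) by (simp add: algebra_simps)
    moreover have "a + g = 1 - d" using agd(5) by simp
    ultimately have "0 \<le> d * m" by (simp add: algebra_simps)
    then have "d = 0" using m0 agd(3) by (metis mult_pos_neg not_le order_le_less)
    then show False using agd(4) s(2) primary_min[OF p] by simp
  qed
  show "invertible_mat A" "\<forall>i<length ps. \<forall>j<length ps. mat_inv A $$ (i, j) \<ge> 0"
    using monotone_matrix_inverse_nonneg[OF A mono] by (auto simp: n_def)
qed

end

section \<open>Implicit functions on boxes\<close>

lemma other_dir_neq [simp]: "other_dir \<mu> \<noteq> \<mu>" "\<mu> \<noteq> other_dir \<mu>"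
  by (auto simp: other_dir_def)

lemma dir_cases: "\<kappa> = \<mu> \<or> \<kappa> = other_dir \<mu>" for \<kappa> \<mu> :: 2
  using exhaust_2[of \<kappa>] exhaust_2[of \<mu>] by (auto simp: other_dir_def)

lemma UNIV_dirs: "UNIV = {\<mu>, other_dir \<mu>}"
  using dir_cases by auto

lemma other_other_dir [simp]: "other_dir (other_dir \<mu>) = \<mu>"
  using exhaust_2[of \<mu>] by (auto simp: other_dir_def)

lemma vec_eq_dirs: "x = y \<longleftrightarrow> x $ \<mu> = y $ \<mu> \<and> x $ other_dir \<mu> = y $ other_dir \<mu>"
proof
  assume eq: "x $ \<mu> = y $ \<mu> \<and> x $ other_dir \<mu> = y $ other_dir \<mu>"
  have "x $ \<kappa> = y $ \<kappa>" for \<kappa> using dir_cases[of \<kappa> \<mu>] eq by auto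
  then show "x = y" by (simp add: Finite_Cartesian_Product.vec_eq_iff)
qed simp

lemma inner_dirs: "x \<bullet> y = x $ \<mu> * y $ \<mu> + x $ other_dir \<mu> * y $ other_dir \<mu>" for x y :: "real^2"
  unfolding inner_vec_def by (simp add: UNIV_dirs[of \<mu>])

lemma norm_sq_dirs: "(norm x)\<^sup>2 = (x $ \<mu>)\<^sup>2 + (x $ other_dir \<mu>)\<^sup>2" for x :: "real^2"
  unfolding power2_norm_eq_inner inner_dirs[of x x \<mu>] by (simp add: power2_eq_square)

lemma norm_le_dirs: "norm x \<le> \<bar>x $ \<mu>\<bar> + \<bar>x $ other_dir \<mu>\<bar>" for x :: "real^2"
  using norm_le_l1_cart[of x] by (simp add: UNIV_dirs[of \<mu>])

lemma graph_point_nth [simp]: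
  "graph_point \<mu> y t $ \<mu> = y t" "graph_point \<mu> y t $ other_dir \<mu> = t"
  by (auto simp: graph_point_def)

lemma graph_point_const: "graph_point \<mu> (\<lambda>_. y t) t = graph_point \<mu> y t"
  by (simp add: graph_point_def)

lemma gderiv_mvt:
  fixes f :: "'a::real_inner \<Rightarrow> real"
  assumes "\<And>x. GDERIV f x :> G x"
  obtains \<xi> where "\<xi> \<in> closed_segment a b" "f b - f a = (b - a) \<bullet> G \<xi>"
proof -
  define g where "g r = f (a + r *\<^sub>R (b - a))" for r :: real
  have "DERIV g r :> (b - a) \<bullet> G (a + r *\<^sub>R (b - a))" for r
    unfolding g_def has_field_derivative_def
  proof (rule has_derivative_eq_rhs)
    show "((\<lambda>r. f (a + r *\<^sub>R (b - a))) has_derivative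
        (\<lambda>d. (d *\<^sub>R (b - a)) \<bullet> G (a + r *\<^sub>R (b - a)))) (at r)"
      by (rule has_derivative_compose[where f = "\<lambda>r. a + r *\<^sub>R (b - a)",
            OF _ assms[unfolded gderiv_def]])
        (auto intro!: derivative_eq_intros)
  qed (auto simp: mult.commute)
  then have "\<exists>r>0. r < 1 \<and> g 1 - g 0 = (1 - 0) * ((b - a) \<bullet> G (a + r *\<^sub>R (b - a)))"
    by (intro MVT2) auto
  then obtain r where r: "0 < r" "r < 1" "g 1 - g 0 = (b - a) \<bullet> G (a + r *\<^sub>R (b - a))"
    by auto
  show thesis
  proof
    show "a + r *\<^sub>R (b - a) \<in> closed_segment a b"
      unfolding in_segment using r by (intro exI[of _ r]) (auto simp: algebra_simps)
    show "f b - f a = (b - a) \<bullet> G (a + r *\<^sub>R (b - a))"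
      using r(3) by (simp add: g_def)
  qed
qed

text \<open>A quantitative implicit function setting: \<mu> is the direction of the graph values,
  \<sigma> the sign of the normal derivative. By \<open>wide\<close>, the zero set cannot reach the
  edges |x_\<mu> - p_\<mu>| = b. Explicit constants make the box size uniform along the
  curve.\<close>

locale implicit_box =
  fixes \<phi> :: "real^2 \<Rightarrow> real" and G :: "real^2 \<Rightarrow> real^2" and p :: "real^2" and \<mu> :: 2
    and a b \<sigma> m L :: real and box :: "(real^2) set"
  defines "box \<equiv> {x. \<bar>x $ other_dir \<mu> - p $ other_dir \<mu>\<bar> < a \<and> \<bar>x $ \<mu> - p $ \<mu>\<bar> \<le> b}"
  assumes gderiv: "\<And>x. GDERIV \<phi> x :> G x"
    and cont: "\<And>x. isCont G x"
    and zero: "\<phi> p = 0"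
    and pos: "a > 0" "b > 0" "m > 0"
    and normal: "\<And>x. x \<in> box \<Longrightarrow> m \<le> \<sigma> * G x $ \<mu>" and \<sigma>: "\<bar>\<sigma>\<bar> = 1"
    and tangential: "\<And>x. x \<in> box \<Longrightarrow> \<bar>G x $ other_dir \<mu>\<bar> \<le> L"
    and wide: "L * a < m * b"
begin

abbreviation "\<nu> \<equiv> other_dir \<mu>"

lemma mvt_box:
  assumes "x \<in> box" "y \<in> box"
  obtains \<xi> where "\<xi> \<in> closed_segment x y" "\<xi> \<in> box"
    "\<phi> y - \<phi> x = (y $ \<mu> - x $ \<mu>) * G \<xi> $ \<mu> + (y $ \<nu> - x $ \<nu>) * G \<xi> $ \<nu>"
proof -
  obtain \<xi> where \<xi>: "\<xi> \<in> closed_segment x y" "\<phi> y - \<phi> x = (y - x) \<bullet> G \<xi>"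
    using gderiv_mvt[OF gderiv] by blast
  have "convex box"
  proof -
    have "box = (\<lambda>x. x $ \<nu>) -` ball (p $ \<nu>) a \<inter> (\<lambda>x. x $ \<mu>) -` cball (p $ \<mu>) b"
      by (auto simp: box_def dist_real_def)
    then show ?thesis
      by (auto intro!: convex_Int convex_linear_vimage bounded_linear.linear bounded_linear_vec_nth)
  qed
  then have "\<xi> \<in> box" using \<xi>(1) assms closed_segment_subset by blast
  then show thesis using that \<xi> inner_dirs[of "y - x" "G \<xi>" \<mu>] by simp
qed

lemma zeros_close:
  assumes "x \<in> box" "y \<in> box" "\<phi> x = 0" "\<phi> y = 0"
  shows "m * \<bar>y $ \<mu> - x $ \<mu>\<bar> \<le> L * \<bar>y $ \<nu> - x $ \<nu>\<bar>"
proof -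
  obtain \<xi> where \<xi>: "\<xi> \<in> box" "(y $ \<mu> - x $ \<mu>) * G \<xi> $ \<mu> + (y $ \<nu> - x $ \<nu>) * G \<xi> $ \<nu> = 0"
    using mvt_box[OF assms(1,2)] assms(3,4) by auto
  have "m \<le> \<bar>G \<xi> $ \<mu>\<bar>"
    using normal[OF \<xi>(1)] \<sigma> abs_mult[of \<sigma> "G \<xi> $ \<mu>"] by simp
  then have "m * \<bar>y $ \<mu> - x $ \<mu>\<bar> \<le> \<bar>(y $ \<mu> - x $ \<mu>) * G \<xi> $ \<mu>\<bar>"
    by (simp add: abs_mult mult.commute mult_right_mono)
  also have "\<dots> = \<bar>(y $ \<nu> - x $ \<nu>) * G \<xi> $ \<nu>\<bar>"
    using \<xi>(2) by linarith
  also have "\<dots> \<le> L * \<bar>y $ \<nu> - x $ \<nu>\<bar>"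
    using tangential[OF \<xi>(1)] mult_right_mono[of "\<bar>G \<xi> $ \<nu>\<bar>" L "\<bar>y $ \<nu> - x $ \<nu>\<bar>"]
    by (simp add: abs_mult mult.commute)
  finally show ?thesis .
qed

lemma p_in_box: "p \<in> box" using pos by (simp add: box_def)

text \<open>Moving from p to an edge changes \<phi> by at least m b through the normal part and by
  at most L a through the tangential part; e selects the edge.\<close>

lemma sign_on_edges:
  assumes t: "\<bar>t - p $ \<nu>\<bar> < a" and e: "\<bar>e\<bar> = 1"
  shows "e * \<sigma> * \<phi> (graph_point \<mu> (\<lambda>_. p $ \<mu> + e * b) t) > 0"
proof -
  define x where "x = graph_point \<mu> (\<lambda>_. p $ \<mu> + e * b) t"
  have "x \<in> box" using t e pos by (simp add: x_def box_def abs_mult)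
  from mvt_box[OF p_in_box this] obtain \<xi> where
    \<xi>: "\<xi> \<in> box" "\<phi> x = e * b * G \<xi> $ \<mu> + (t - p $ \<nu>) * G \<xi> $ \<nu>"
    using zero by (auto simp: x_def)
  have ee: "e * e = 1" "e * (e * z) = z" for z using e by (auto simp: abs_if split: if_splits)
  have "\<bar>(e * \<sigma>) * ((t - p $ \<nu>) * G \<xi> $ \<nu>)\<bar> \<le> a * L"
    using t e \<sigma> pos tangential[OF \<xi>(1)] unfolding abs_mult by (simp add: mult_mono)
  moreover have "m * b \<le> (\<sigma> * G \<xi> $ \<mu>) * b"
    using normal[OF \<xi>(1)] pos by (intro mult_right_mono) auto
  moreover have "e * \<sigma> * \<phi> x = (\<sigma> * G \<xi> $ \<mu>) * b + (e * \<sigma>) * ((t - p $ \<nu>) * G \<xi> $ \<nu>)"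
    unfolding \<xi>(2) by (simp add: algebra_simps ee)
  ultimately show ?thesis using wide unfolding x_def by (simp add: mult.commute)
qed

text \<open>The mean value identity between two zeros makes the difference quotient of y equal to
  the gradient quotient at an intermediate point \<xi> r. By \<open>zeros_close\<close>, \<xi> r
  tends to the point at t, and G is continuous.\<close>

lemma graph_has_derivative:
  assumes y: "\<And>t. \<bar>t - p $ \<nu>\<bar> < a \<Longrightarrow> graph_point \<mu> y t \<in> box \<and> \<phi> (graph_point \<mu> y t) = 0"
    and t: "\<bar>t - p $ \<nu>\<bar> < a"
  shows "(y has_real_derivative
           - (G (graph_point \<mu> y t) $ \<nu> / G (graph_point \<mu> y t) $ \<mu>)) (at t)"
proof -
  define P where "P = graph_point \<mu> y"
  have P: "P r \<in> box" "\<phi> (P r) = 0" if "\<bar>r - p $ \<nu>\<bar> < a" for r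
    using y[OF that] by (auto simp: P_def)
  have P_nth: "P r $ \<mu> = y r" "P r $ \<nu> = r" for r by (simp_all add: P_def)
  define \<xi> where "\<xi> r = (SOME z. z \<in> closed_segment (P t) (P r) \<and> z \<in> box \<and>
      \<phi> (P r) - \<phi> (P t) = (y r - y t) * G z $ \<mu> + (r - t) * G z $ \<nu>)" for r
  have \<xi>: "\<xi> r \<in> closed_segment (P t) (P r)" "\<xi> r \<in> box"
      "(y r - y t) * G (\<xi> r) $ \<mu> + (r - t) * G (\<xi> r) $ \<nu> = 0" if r: "\<bar>r - p $ \<nu>\<bar> < a" for r
  proof -
    have "\<exists>z. z \<in> closed_segment (P t) (P r) \<and> z \<in> box \<and>
      \<phi> (P r) - \<phi> (P t) = (y r - y t) * G z $ \<mu> + (r - t) * G z $ \<nu>"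
      using mvt_box[OF P(1)[OF t] P(1)[OF r]] P_nth by metis
    from someI_ex[OF this] show "\<xi> r \<in> closed_segment (P t) (P r)" "\<xi> r \<in> box"
      "(y r - y t) * G (\<xi> r) $ \<mu> + (r - t) * G (\<xi> r) $ \<nu> = 0"
      using P(2)[OF t] P(2)[OF r] unfolding \<xi>_def by auto
  qed
  have near_t: "eventually (\<lambda>r. \<bar>r - p $ \<nu>\<bar> < a) (at t)"
  proof (rule eventually_at_topological[THEN iffD2], intro exI conjI ballI impI)
    show "open {r. \<bar>r - p $ \<nu>\<bar> < a}" by (intro open_Collect_less continuous_intros)
  qed (use t in auto)
  have bound: "dist (\<xi> r) (P t) \<le> (1 + L / m) * \<bar>r - t\<bar>" if r: "\<bar>r - p $ \<nu>\<bar> < a" for r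
  proof -
    have "dist (\<xi> r) (P t) \<le> dist (P r) (P t)"
      using \<xi>(1)[OF r] segment_bound(1)[of "\<xi> r" "P t" "P r"] by (simp add: dist_norm)
    also have "\<dots> \<le> \<bar>y r - y t\<bar> + \<bar>r - t\<bar>"
      using norm_le_dirs[of "P r - P t" \<mu>] by (simp add: dist_norm P_nth)
    also have "\<bar>y r - y t\<bar> \<le> L / m * \<bar>r - t\<bar>"
      using zeros_close[OF P(1)[OF t] P(1)[OF r] P(2)[OF t] P(2)[OF r]] pos
      by (simp add: P_nth field_simps)
    finally show ?thesis by (simp add: algebra_simps)
  qed
  have "(\<xi> \<longlongrightarrow> P t) (at t)"
  proof (rule tendsto_dist_iff[THEN iffD2], rule tendsto_sandwich[where f = "\<lambda>_. 0"])
    show "((\<lambda>r. (1 + L / m) * \<bar>r - t\<bar>) \<longlongrightarrow> 0) (at t)"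
      by (auto intro!: tendsto_eq_intros)
    show "eventually (\<lambda>r. dist (\<xi> r) (P t) \<le> (1 + L / m) * \<bar>r - t\<bar>) (at t)"
      using near_t by eventually_elim (rule bound)
  qed auto
  then have "((\<lambda>r. G (\<xi> r)) \<longlongrightarrow> G (P t)) (at t)"
    using cont isCont_tendsto_compose by blast
  moreover have "G (P t) $ \<mu> \<noteq> 0"
    using normal[OF P(1)[OF t]] pos by auto
  ultimately have "((\<lambda>r. - (G (\<xi> r) $ \<nu> / G (\<xi> r) $ \<mu>)) \<longlongrightarrow> - (G (P t) $ \<nu> / G (P t) $ \<mu>)) (at t)"
    by (intro tendsto_intros) auto
  moreover have "eventually (\<lambda>r. - (G (\<xi> r) $ \<nu> / G (\<xi> r) $ \<mu>) = (y r - y t) / (r - t)) (at t)"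
    using near_t eventually_neq_at_within[of t t]
  proof eventually_elim
    case (elim r)
    have "m \<le> \<sigma> * G (\<xi> r) $ \<mu>" using normal[OF \<xi>(2)[OF elim(1)]] .
    then have "G (\<xi> r) $ \<mu> \<noteq> 0" using pos by auto
    moreover have "(- G (\<xi> r) $ \<nu>) * (r - t) = (y r - y t) * G (\<xi> r) $ \<mu>"
      using \<xi>(3)[OF elim(1)] by (simp add: algebra_simps)
    ultimately have "(- G (\<xi> r) $ \<nu>) / G (\<xi> r) $ \<mu> = (y r - y t) / (r - t)"
      using elim(2) by (simp only: frac_eq_eq right_minus_eq not_False_eq_True)
    then show ?case by simp
  qed
  ultimately show ?thesis
    unfolding has_field_derivative_iff P_def[symmetric] by (rule Lim_transform_eventually)
qed

text \<open>Opposite signs on the two edges give a zero over each parameter, and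
  \<open>zeros_close\<close> forces the zero over the parameter of p to be p.\<close>

lemma graph_exists:
  "\<exists>y. y (p $ \<nu>) = p $ \<mu> \<and>
     (\<forall>t. \<bar>t - p $ \<nu>\<bar> < a \<longrightarrow> y differentiable (at t) \<and> \<phi> (graph_point \<mu> y t) = 0)"
proof -
  have "\<exists>v. \<bar>t - p $ \<nu>\<bar> < a \<longrightarrow> \<bar>v - p $ \<mu>\<bar> \<le> b \<and> \<phi> (graph_point \<mu> (\<lambda>_. v) t) = 0" for t
  proof (cases "\<bar>t - p $ \<nu>\<bar> < a")
    case True
    define g where "g v = \<sigma> * \<phi> (graph_point \<mu> (\<lambda>_. v) t)" for v
    have "continuous_on UNIV \<phi>"
      using gderiv unfolding gderiv_def
      by (meson has_derivative_continuous continuous_at_imp_continuous_on)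
    then have "continuous_on {p $ \<mu> - b..p $ \<mu> + b} g" unfolding g_def
    proof (intro continuous_on_mult continuous_on_const, rule continuous_on_compose2)
      show "continuous_on {p $ \<mu> - b..p $ \<mu> + b} (\<lambda>v. graph_point \<mu> (\<lambda>_. v) t)"
        unfolding graph_point_def
      proof (rule continuous_on_vec_lambda)
        show "continuous_on {p $ \<mu> - b..p $ \<mu> + b} (\<lambda>v. if \<kappa> = \<mu> then v else t)" for \<kappa>
          by (cases "\<kappa> = \<mu>") simp_all
      qed
    qed auto
    moreover have "g (p $ \<mu> - b) \<le> 0" "0 \<le> g (p $ \<mu> + b)"
      using sign_on_edges[OF True, of "- 1"] sign_on_edges[OF True, of 1] by (auto simp: g_def)
    ultimately obtain v where "p $ \<mu> - b \<le> v" "v \<le> p $ \<mu> + b" "g v = 0"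
      using IVT'[of g "p $ \<mu> - b" 0 "p $ \<mu> + b"] pos by auto
    moreover have "\<sigma> \<noteq> 0" using \<sigma> by auto
    ultimately show ?thesis by (intro exI[of _ v]) (auto simp: g_def)
  qed auto
  then obtain y where y: "\<And>t. \<bar>t - p $ \<nu>\<bar> < a \<Longrightarrow>
      \<bar>y t - p $ \<mu>\<bar> \<le> b \<and> \<phi> (graph_point \<mu> (\<lambda>_. y t) t) = 0" by metis
  then have y': "graph_point \<mu> y t \<in> box \<and> \<phi> (graph_point \<mu> y t) = 0" if "\<bar>t - p $ \<nu>\<bar> < a" for t
    using that by (simp add: box_def graph_point_const)
  have "m * \<bar>y (p $ \<nu>) - p $ \<mu>\<bar> \<le> 0"
    using zeros_close[OF p_in_box, of "graph_point \<mu> y (p $ \<nu>)"] y' zero pos by simp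
  then have "y (p $ \<nu>) = p $ \<mu>" using pos by (simp add: mult_le_0_iff)
  moreover have "y differentiable (at t)" if "\<bar>t - p $ \<nu>\<bar> < a" for t
    unfolding real_differentiable_def using graph_has_derivative[OF _ that] y' by blast
  ultimately show ?thesis using y' by blast
qed

text \<open>This controls an arbitrary choice of \<open>local_graph\<close>: a continuous graph of
  zeros starting at p would have to cross an edge of the box, where \<phi> does not vanish.\<close>

lemma graph_in_box:
  assumes start: "y (p $ \<nu>) = p $ \<mu>"
    and cont_y: "\<And>t. \<bar>t - p $ \<nu>\<bar> < a \<Longrightarrow> isCont y t"
    and zero_y: "\<And>t. \<bar>t - p $ \<nu>\<bar> < a \<Longrightarrow> \<phi> (graph_point \<mu> y t) = 0"
    and t: "\<bar>t - p $ \<nu>\<bar> < a"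
  shows "graph_point \<mu> y t \<in> box"
proof (rule ccontr)
  assume "graph_point \<mu> y t \<notin> box"
  then have far: "b < \<bar>y t - p $ \<mu>\<bar>" using t by (simp add: box_def)
  \<comment> \<open>Walking from the parameter of p to t over [0, 1] treats both signs of
    \<open>t - p $ \<nu>\<close> at once.\<close>
  define r where "r u = p $ \<nu> + u * (t - p $ \<nu>)" for u
  have r: "\<bar>r u - p $ \<nu>\<bar> < a" if "0 \<le> u" "u \<le> 1" for u
    using that t mult_right_mono[of u 1 "\<bar>t - p $ \<nu>\<bar>"] by (simp add: r_def abs_mult)
  have "continuous_on {0..1} (\<lambda>u. \<bar>y (r u) - p $ \<mu>\<bar>)"
  proof (intro continuous_intros continuous_on_compose2[where f = r and g = y])
    show "continuous_on {r. \<bar>r - p $ \<nu>\<bar> < a} y"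
      by (intro continuous_at_imp_continuous_on) (auto intro: cont_y)
    show "continuous_on {0..1} r" unfolding r_def by (intro continuous_intros)
  qed (use r in auto)
  then obtain u where u: "0 \<le> u" "u \<le> 1" "\<bar>y (r u) - p $ \<mu>\<bar> = b"
    using IVT'[of "\<lambda>u. \<bar>y (r u) - p $ \<mu>\<bar>" 0 b 1] far start pos by (auto simp: r_def)
  then obtain e where e: "\<bar>e\<bar> = 1" "y (r u) = p $ \<mu> + e * b"
  proof (cases "y (r u) \<ge> p $ \<mu>")
    case True
    then show ?thesis using that[of 1] u by auto
  next
    case False
    then show ?thesis using that[of "- 1"] u by auto
  qed
  then have "e * \<sigma> * \<phi> (graph_point \<mu> y (r u)) > 0"
    using sign_on_edges[OF r[OF u(1,2)] e(1)] graph_point_const[of \<mu> y "r u"] by simp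
  then show False using zero_y[OF r[OF u(1,2)]] by simp
qed

end

section \<open>Geometry of the curve and its cut points\<close>

text \<open>Replacing the norm and replacing the component each cost at most
  \<open>norm (u - v) / norm v\<close>.\<close>

lemma normalized_component_diff:
  fixes u v :: "real^'n"
  assumes "u \<noteq> 0" "v \<noteq> 0"
  shows "\<bar>\<bar>u $ i\<bar> / norm u - \<bar>v $ i\<bar> / norm v\<bar> \<le> 2 * norm (u - v) / norm v"
proof -
  have pos: "norm u > 0" "norm v > 0" using assms by simp_all
  have eq: "\<bar>u $ i\<bar> / norm u - \<bar>v $ i\<bar> / norm v =
      \<bar>u $ i\<bar> / norm u * ((norm v - norm u) / norm v) + (\<bar>u $ i\<bar> - \<bar>v $ i\<bar>) / norm v"
    using pos by (simp add: field_simps)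
  have 1: "\<bar>\<bar>u $ i\<bar> / norm u * ((norm v - norm u) / norm v)\<bar> \<le> 1 * (norm (u - v) / norm v)"
    unfolding abs_mult
  proof (rule mult_mono)
    show "\<bar>\<bar>u $ i\<bar> / norm u\<bar> \<le> 1" using component_le_norm_cart[of u i] pos by simp
    have "\<bar>norm v - norm u\<bar> \<le> norm (u - v)" by (metis norm_minus_commute norm_triangle_ineq3)
    then show "\<bar>(norm v - norm u) / norm v\<bar> \<le> norm (u - v) / norm v"
      using pos by (simp add: divide_right_mono)
  qed auto
  have 2: "\<bar>(\<bar>u $ i\<bar> - \<bar>v $ i\<bar>) / norm v\<bar> \<le> norm (u - v) / norm v"
  proof -
    have "\<bar>\<bar>u $ i\<bar> - \<bar>v $ i\<bar>\<bar> \<le> norm (u - v)"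
      using component_le_norm_cart[of "u - v" i] abs_triangle_ineq3[of "u $ i" "v $ i"] by simp
    then show ?thesis using pos by (simp add: divide_right_mono)
  qed
  show ?thesis
    unfolding eq using order_trans[OF abs_triangle_ineq add_mono[OF 1 2]] by simp
qed

lemma grad_eq:
  assumes "GDERIV \<phi> x :> D"
  shows "grad \<phi> x = D"
  unfolding grad_def
proof (rule the_equality)
  show "GDERIV \<phi> x :> D" by (rule assms)
  fix D' assume "GDERIV \<phi> x :> D'"
  then have "(\<lambda>h. h \<bullet> D') = (\<lambda>h. h \<bullet> D)"
    using assms unfolding gderiv_def by (rule has_derivative_unique)
  then have "h \<bullet> D' = h \<bullet> D" for h by (rule fun_cong)
  then show "D' = D" using vector_eq_ldot by blast
qed

locale regular_curve =
  fixes \<phi> :: "real^2 \<Rightarrow> real" and G :: "real^2 \<Rightarrow> real^2" and M c0 :: real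
  assumes gderiv: "\<And>x. GDERIV \<phi> x :> G x"
    and cont: "\<And>x. isCont G x"
    and lipschitz: "\<And>p x y. \<phi> p = 0 \<Longrightarrow> dist p x \<le> 1 \<Longrightarrow> dist p y \<le> 1 \<Longrightarrow>
          norm (G x - G y) \<le> M * dist x y"
    and lower: "\<And>p. \<phi> p = 0 \<Longrightarrow> c0 \<le> norm (G p)"
    and M_pos: "M > 0" and c0_pos: "c0 > 0"
begin

lemma unit_normal_nth: "unit_normal \<phi> x $ \<mu> = G x $ \<mu> / norm (G x)"
  unfolding unit_normal_def grad_eq[OF gderiv] by (simp add: divide_inverse mult.commute)

text \<open>The sum of the half-widths 9 / \<eta> and 2 of the box around p, in units of h; it
  bounds the distance of its points from p.\<close>

definition box_ratio :: "real \<Rightarrow> real" where "box_ratio \<eta> = 9 / \<eta> + 2"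

text \<open>The graph has slope -G_\<nu> / G_\<mu> with \<nu> the other direction, so the metric
  coefficient is a normal component. Bounds for the coefficients thereby become bounds for the unit
  normal.\<close>

lemma local_graph_props:
  assumes p: "\<phi> p = 0" "\<eta> * norm (G p) \<le> \<bar>G p $ \<mu>\<bar>"
    and \<eta>: "0 < \<eta>" "\<eta> \<le> 1" and h: "h > 0"
    and small: "box_ratio \<eta> * h \<le> 1" "M * (box_ratio \<eta> * h) \<le> \<eta> * c0 / 2"
  defines "y \<equiv> local_graph \<phi> h \<mu> p"
  shows "graph_point \<mu> y (p $ other_dir \<mu>) = p"
    and "\<And>t. \<bar>t - p $ other_dir \<mu>\<bar> < 2 * h \<Longrightarrow>
           \<phi> (graph_point \<mu> y t) = 0 \<and> dist p (graph_point \<mu> y t) \<le> box_ratio \<eta> * h \<and>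
           1 / sqrt (1 + (deriv y t)\<^sup>2) = \<bar>unit_normal \<phi> (graph_point \<mu> y t) $ \<mu>\<bar>"
proof -
  define N where "N = norm (G p)"
  define box where "box = {x. \<bar>x $ other_dir \<mu> - p $ other_dir \<mu>\<bar> < 2 * h \<and> \<bar>x $ \<mu> - p $ \<mu>\<bar> \<le> 9 / \<eta> * h}"
  have N: "N > 0" "c0 \<le> N" using lower[OF p(1)] c0_pos by (auto simp: N_def)
  have box_dist: "dist p x \<le> box_ratio \<eta> * h" if "x \<in> box" for x
    using that norm_le_dirs[of "x - p" \<mu>] by (simp add: box_def dist_norm norm_minus_commute box_ratio_def algebra_simps)
  \<comment> \<open>The gradient changes by at most half of the lower bound \<eta> N for its normal
    component, so at least \<eta> N / 2 of that component survives in the box.\<close>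
  have diff: "norm (G x - G p) \<le> \<eta> * N / 2" if x: "x \<in> box" for x
  proof -
    have "norm (G x - G p) \<le> M * dist x p"
      using lipschitz[OF p(1), of x p] box_dist[OF x] small by simp
    also have "\<dots> \<le> M * (box_ratio \<eta> * h)"
      using box_dist[OF x] M_pos by (simp add: dist_commute)
    also have "\<dots> \<le> \<eta> * c0 / 2" by (rule small(2))
    also have "\<dots> \<le> \<eta> * N / 2" using N(2) \<eta> by (simp add: mult_left_mono)
    finally show ?thesis .
  qed
  have comp: "\<bar>G x $ \<kappa> - G p $ \<kappa>\<bar> \<le> \<eta> * N / 2" if x: "x \<in> box" for x \<kappa>
    using diff[OF x] component_le_norm_cart[of "G x - G p" \<kappa>] by simp
  interpret implicit_box \<phi> G p \<mu> "2 * h" "9 / \<eta> * h" "sgn (G p $ \<mu>)" "\<eta> * N / 2" "2 * N" box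
  proof (unfold_locales, fold box_def)
    have "\<eta> * N > 0" using \<eta> N by simp
    then have nz: "G p $ \<mu> \<noteq> 0" using p(2) by (auto simp: N_def)
    then show "\<bar>sgn (G p $ \<mu>)\<bar> = 1" by (simp add: abs_sgn_eq)
    show "\<eta> * N / 2 \<le> sgn (G p $ \<mu>) * G x $ \<mu>" if "x \<in> box" for x
    proof (cases "G p $ \<mu> > 0")
      case True
      then show ?thesis using comp[OF that, of \<mu>, unfolded abs_le_iff] p(2)[folded N_def] by simp
    next
      case False
      then have "G p $ \<mu> < 0" using nz by simp
      then show ?thesis using comp[OF that, of \<mu>, unfolded abs_le_iff] p(2)[folded N_def] by simp
    qed
    show "\<bar>G x $ other_dir \<mu>\<bar> \<le> 2 * N" if "x \<in> box" for x
    proof -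
      have "\<bar>G p $ other_dir \<mu>\<bar> \<le> N" unfolding N_def by (rule component_le_norm_cart)
      moreover have "\<eta> * N \<le> 1 * N" using \<eta> N by (intro mult_right_mono) auto
      ultimately show ?thesis using comp[OF that, of "other_dir \<mu>"] N by linarith
    qed
    \<comment> \<open>\<open>wide\<close> needs a half-height above 8 h / \<eta>, which explains the
      9.\<close>
    have "\<eta> * N / 2 * (9 / \<eta> * h) = 9 / 2 * (N * h)" using \<eta> by simp
    moreover have "N * h > 0" using N h by simp
    ultimately show "2 * N * (2 * h) < \<eta> * N / 2 * (9 / \<eta> * h)" by linarith
    show "\<eta> * N / 2 > 0" "9 / \<eta> * h > 0" "2 * h > 0" using \<eta> N h by simp_all
  qed (fact gderiv cont p(1) | simp)+
  have y: "y (p $ other_dir \<mu>) = p $ \<mu> \<and> (\<forall>t. \<bar>t - p $ other_dir \<mu>\<bar> < 2 * h \<longrightarrow>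
       y differentiable (at t) \<and> \<phi> (graph_point \<mu> y t) = 0)"
    unfolding y_def local_graph_def by (fact someI_ex[OF graph_exists])
  then show "graph_point \<mu> y (p $ other_dir \<mu>) = p"
    using vec_eq_dirs[of _ p \<mu>] by simp
  have cont_y: "isCont y t" if "\<bar>t - p $ other_dir \<mu>\<bar> < 2 * h" for t
    using y that differentiable_imp_continuous_within by blast
  have zero_y: "\<phi> (graph_point \<mu> y t) = 0" if "\<bar>t - p $ other_dir \<mu>\<bar> < 2 * h" for t
    using y that by blast
  note in_box = graph_in_box[OF y[THEN conjunct1] cont_y zero_y]
  fix t assume t: "\<bar>t - p $ other_dir \<mu>\<bar> < 2 * h"
  define P where "P = graph_point \<mu> y t"
  have P: "P \<in> box" "\<phi> P = 0" using in_box[OF _ _ t] zero_y[OF t] by (simp_all add: P_def)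
  have deriv_eq: "deriv y t = - (G P $ other_dir \<mu> / G P $ \<mu>)"
    unfolding P_def using graph_has_derivative[OF conjI[OF in_box zero_y] t] by (intro DERIV_imp_deriv) simp
  have "G P $ \<mu> \<noteq> 0" using normal[OF P(1)] pos by auto
  then have "1 + (deriv y t)\<^sup>2 = (norm (G P) / G P $ \<mu>)\<^sup>2"
    unfolding deriv_eq power_divide norm_sq_dirs[of "G P" \<mu>] by (simp add: field_simps power_divide)
  then have "1 / sqrt (1 + (deriv y t)\<^sup>2) = \<bar>unit_normal \<phi> P $ \<mu>\<bar>"
    by (simp add: unit_normal_nth abs_divide)
  then show "\<phi> (graph_point \<mu> y t) = 0 \<and> dist p (graph_point \<mu> y t) \<le> box_ratio \<eta> * h \<and>
     1 / sqrt (1 + (deriv y t)\<^sup>2) = \<bar>unit_normal \<phi> (graph_point \<mu> y t) $ \<mu>\<bar>"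
    using P box_dist by (simp add: P_def)
qed

lemma unit_normal_diff:
  assumes "\<phi> p = 0" "\<phi> x = 0" "dist p x \<le> 1"
  shows "\<bar>\<bar>unit_normal \<phi> x $ \<mu>\<bar> - \<bar>unit_normal \<phi> p $ \<mu>\<bar>\<bar> \<le> 2 * M * dist p x / c0"
proof -
  have "\<bar>\<bar>unit_normal \<phi> x $ \<mu>\<bar> - \<bar>unit_normal \<phi> p $ \<mu>\<bar>\<bar> \<le> 2 * norm (G x - G p) / norm (G p)"
  proof -
    have "G z \<noteq> 0" if "\<phi> z = 0" for z using lower[OF that] c0_pos by auto
    then show ?thesis
      using normalized_component_diff[of "G x" "G p" \<mu>] assms by (simp add: unit_normal_nth abs_divide)
  qed
  also have "\<dots> \<le> (2 * M * dist p x) / c0"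
    using lipschitz[OF assms(1), of x p] lower[of p] assms c0_pos M_pos
    by (intro frac_le) (auto simp: dist_commute)
  finally show ?thesis .
qed

end

section \<open>Cut points, their grid points, and the slope at primary points\<close>

lemma grid_nth_eq:
  assumes "g \<in> grid h" "g' \<in> grid h" "\<bar>g $ \<kappa> - g' $ \<kappa>\<bar> < h"
  shows "g $ \<kappa> = g' $ \<kappa>"
proof -
  obtain i j :: int where ij: "g $ \<kappa> = of_int i * h" "g' $ \<kappa> = of_int j * h"
    using assms(1,2) unfolding grid_def by blast
  have "h > 0" using assms(3) by linarith
  moreover have "\<bar>of_int (i - j)\<bar> * h < 1 * h"
    using assms(3) \<open>h > 0\<close> by (simp add: ij abs_mult flip: left_diff_distrib)
  ultimately have "\<bar>of_int (i - j) :: real\<bar> < 1" by (simp only: mult_less_cancel_right_pos)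
  then have "i = j" by linarith
  then show ?thesis by (simp add: ij)
qed

lemma grid_add_axis:
  assumes "g \<in> grid h"
  shows "g + h *\<^sub>R axis \<kappa> 1 \<in> grid h" "g - h *\<^sub>R axis \<kappa> 1 \<in> grid h"
proof -
  have "\<exists>i::int. g $ \<nu> + h * axis \<kappa> 1 $ \<nu> = of_int i * h"
       "\<exists>i::int. g $ \<nu> - h * axis \<kappa> 1 $ \<nu> = of_int i * h" for \<nu>
  proof -
    obtain i :: int where i: "g $ \<nu> = of_int i * h" using assms unfolding grid_def by blast
    show "\<exists>i::int. g $ \<nu> + h * axis \<kappa> 1 $ \<nu> = of_int i * h"
      by (intro exI[of _ "if \<nu> = \<kappa> then i + 1 else i"]) (simp add: i axis_def algebra_simps)
    show "\<exists>i::int. g $ \<nu> - h * axis \<kappa> 1 $ \<nu> = of_int i * h"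
      by (intro exI[of _ "if \<nu> = \<kappa> then i - 1 else i"]) (simp add: i axis_def algebra_simps)
  qed
  then show "g + h *\<^sub>R axis \<kappa> 1 \<in> grid h" "g - h *\<^sub>R axis \<kappa> 1 \<in> grid h"
    unfolding grid_def by simp_all
qed

lemma axis_dirs [simp]:
  "axis \<mu> (1::real) $ \<mu> = 1" "axis \<mu> (1::real) $ other_dir \<mu> = 0" "axis (other_dir \<mu>) (1::real) $ \<mu> = 0"
  by (auto simp: axis_def)

locale regular_cut_points =
  regular_curve \<phi> G M c0 + cut_points \<phi> \<eta> h ins dir near prim ps ss
  for \<phi> G M c0 \<eta> h ins dir near prim ps ss +
  assumes h: "h > 0" and \<eta>: "0 < \<eta>" "\<eta> < 1 / sqrt 2"
    and small: "2 * h \<le> 1" "box_ratio \<eta> * h \<le> 1" "M * (box_ratio \<eta> * h) \<le> \<eta> * c0 / 2"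
begin

lemma cut_zero: "p \<in> cuts \<phi> \<eta> h ins \<Longrightarrow> \<phi> p = 0"
  by (auto simp: cuts_def cuts_in_dir_def)

text \<open>The distances to the endpoints of the grid interval add up to h, so the closest grid
  point is within h / 2. Across the interval, two grid coordinates less than h apart agree.\<close>

lemma cut_near:
  assumes s: "s \<in> cuts_in_dir \<phi> \<eta> h ins \<mu>"
  shows "\<bar>s $ \<mu> - near s $ \<mu>\<bar> \<le> h / 2" "s $ other_dir \<mu> = near s $ other_dir \<mu>"
proof -
  have "s \<in> cuts \<phi> \<eta> h ins" using s by (auto simp: cuts_def)
  then have near_s: "near s \<in> grid h" "\<And>g. g \<in> grid h \<Longrightarrow> dist s (near s) \<le> dist s g"
    using near by auto
  obtain g where g: "g \<in> grid h" "s \<in> closed_segment g (g + h *\<^sub>R axis \<mu> 1)"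
    using s by (auto simp: cuts_in_dir_def)
  then obtain a where a: "0 \<le> a" "a \<le> 1" "s = (1 - a) *\<^sub>R g + a *\<^sub>R (g + h *\<^sub>R axis \<mu> 1)"
    by (auto simp: in_segment)
  have s_eq: "s = g + (a * h) *\<^sub>R axis \<mu> 1" using a(3) by (simp add: algebra_simps)
  have "dist s g = a * h" using s_eq a h by (simp add: dist_norm)
  moreover have "dist s (g + h *\<^sub>R axis \<mu> 1) = (1 - a) * h"
  proof -
    have "s - (g + h *\<^sub>R axis \<mu> 1) = ((a - 1) * h) *\<^sub>R axis \<mu> 1" using s_eq by (simp add: algebra_simps)
    then show ?thesis using a h by (simp add: dist_norm abs_mult)
  qed
  ultimately have "dist s (near s) \<le> h / 2"
    using near_s(2)[OF g(1)] near_s(2)[OF grid_add_axis(1)[OF g(1), of \<mu>]] by (simp add: algebra_simps)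
  then have comp: "\<bar>s $ \<kappa> - near s $ \<kappa>\<bar> \<le> h / 2" for \<kappa>
    using component_le_norm_cart[of "s - near s" \<kappa>] by (simp add: dist_norm)
  then show "\<bar>s $ \<mu> - near s $ \<mu>\<bar> \<le> h / 2" .
  have "s $ other_dir \<mu> = g $ other_dir \<mu>" by (simp add: s_eq)
  then show "s $ other_dir \<mu> = near s $ other_dir \<mu>"
    using grid_nth_eq[OF g(1) near_s(1), of "other_dir \<mu>"] comp[of "other_dir \<mu>"] h by simp
qed

lemma theta_bound: "s \<in> set ss \<Longrightarrow> \<bar>theta s\<bar> \<le> 1/2"
  using cut_near(1)[of s "dir s"] dir secondary h by (simp add: theta_def field_simps)

lemma primary_props:
  assumes "p \<in> set ps"
  shows "p \<in> cuts \<phi> \<eta> h ins" "prim (near p) = p" "p \<in> cuts_in_dir \<phi> \<eta> h ins (dir p)"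
  using assms primary prim dir by auto

text \<open>
  Where the curve is steeper than the diagonal, it meets the other grid line through \<open>near p\<close> in
  a cut point closer to \<open>near p\<close>, so \<open>p\<close> would not be primary.
\<close>

lemma primary_slope:
  assumes p: "p \<in> set ps" and \<mu>: "\<mu> = dir p"
  shows "\<bar>G p $ other_dir \<mu>\<bar> \<le> \<bar>G p $ \<mu>\<bar> + 4 * M * h"
proof (rule ccontr)
  define \<nu> where "\<nu> = other_dir \<mu>"
  assume "\<not> ?thesis"
  then have steep: "\<bar>G p $ \<mu>\<bar> + 4 * M * h < \<bar>G p $ \<nu>\<bar>" by (simp add: \<nu>_def)
  note p_props = primary_props[OF p, folded \<mu>]
  have p0: "\<phi> p = 0" using cut_zero p_props(1) .
  define \<sigma> where "\<sigma> = sgn (G p $ \<nu>)"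
  have "G p $ \<nu> \<noteq> 0" using steep M_pos h by (smt (verit) mult_pos_pos)
  then have \<sigma>: "\<bar>\<sigma>\<bar> = 1" "\<sigma> * G p $ \<nu> = \<bar>G p $ \<nu>\<bar>"
    by (auto simp: \<sigma>_def abs_sgn_eq sgn_if)
  \<comment> \<open>Each gradient component moves by at most 2 M h within distance 2 h, so a gap of
    4 M h at p survives as a strict inequality.\<close>
  have steep_near: "\<bar>G x $ \<mu>\<bar> < \<sigma> * G x $ \<nu>" if x: "dist p x \<le> 2 * h" for x
  proof -
    have "norm (G x - G p) \<le> M * dist x p" using lipschitz[OF p0, of x p] x small by simp
    also have "\<dots> \<le> M * (2 * h)" using x M_pos by (simp add: dist_commute)
    finally have d: "\<bar>G x $ \<kappa> - G p $ \<kappa>\<bar> \<le> 2 * M * h" for \<kappa>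
      using component_le_norm_cart[of "G x - G p" \<kappa>] by simp
    have "\<bar>\<sigma> * G x $ \<nu> - \<sigma> * G p $ \<nu>\<bar> \<le> 2 * M * h"
      using d[of \<nu>] \<sigma>(1) by (simp add: abs_mult flip: right_diff_distrib)
    then show ?thesis using d[of \<mu>] steep \<sigma>(2) by linarith
  qed
  define g where "g = near p"
  have g: "g \<in> grid h" using near p_props(1) by (simp add: g_def)
  define \<tau> where "\<tau> = p $ \<mu> - g $ \<mu>"
  have \<tau>: "\<bar>\<tau>\<bar> \<le> h / 2" and p_\<nu>: "p $ \<nu> = g $ \<nu>"
    using cut_near[OF p_props(3)] by (auto simp: \<tau>_def g_def \<nu>_def)
  define Q where "Q e = g + e *\<^sub>R axis \<nu> 1" for e :: real
  have Q_nth: "Q e $ \<mu> = g $ \<mu>" "Q e $ \<nu> = g $ \<nu> + e" for e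
    by (auto simp: Q_def \<nu>_def)
  have Q_dist: "dist p (Q e) \<le> \<bar>\<tau>\<bar> + \<bar>e\<bar>" for e
    using norm_le_dirs[of "p - Q e" \<mu>] p_\<nu> by (simp add: dist_norm Q_nth \<tau>_def flip: \<nu>_def)
  have segment_near: "dist p z \<le> 2 * h" if "z \<in> closed_segment x y" "dist p x \<le> 2 * h" "dist p y \<le> 2 * h" for x y z
    using closed_segment_subset[of x "cball p (2 * h)" y] that by (auto simp: convex_cball)
  \<comment> \<open>From p to \<open>Q e\<close> the displacement is -\<tau> along \<mu> and e along
    \<nu>. Steepness lets the second part dominate when |e| \<ge> |\<tau>|, so it fixes the sign of
    \<phi>.\<close>
  have off: "\<sigma> * (sgn e * \<phi> (Q e)) > 0" if e: "\<bar>\<tau>\<bar> \<le> \<bar>e\<bar>" "\<bar>e\<bar> \<le> h" "e \<noteq> 0" for e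
  proof -
    obtain \<xi> where \<xi>: "\<xi> \<in> closed_segment p (Q e)" "\<phi> (Q e) - \<phi> p = (Q e - p) \<bullet> G \<xi>"
      using gderiv_mvt[OF gderiv] by blast
    have "dist p \<xi> \<le> 2 * h"
      using segment_near[OF \<xi>(1)] Q_dist[of e] e \<tau> h by simp
    then have st: "\<bar>G \<xi> $ \<mu>\<bar> < \<sigma> * G \<xi> $ \<nu>" by (rule steep_near)
    have \<phi>Q: "\<phi> (Q e) = e * G \<xi> $ \<nu> - \<tau> * G \<xi> $ \<mu>"
      using \<xi>(2) p0 p_\<nu> inner_dirs[of "Q e - p" "G \<xi>" \<mu>]
      by (simp add: Q_nth \<tau>_def algebra_simps flip: \<nu>_def)
    have "\<bar>e\<bar> = sgn e * e" by (simp add: abs_sgn mult.commute)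
    then have "\<sigma> * (sgn e * \<phi> (Q e)) = \<bar>e\<bar> * (\<sigma> * G \<xi> $ \<nu>) - (\<sigma> * sgn e) * (\<tau> * G \<xi> $ \<mu>)"
      unfolding \<phi>Q by (simp only:) (simp add: algebra_simps)
    moreover have "\<bar>(\<sigma> * sgn e) * (\<tau> * G \<xi> $ \<mu>)\<bar> = \<bar>\<tau>\<bar> * \<bar>G \<xi> $ \<mu>\<bar>"
      using \<sigma>(1) e(3) by (simp add: abs_mult abs_sgn_eq)
    moreover have "\<bar>\<tau>\<bar> * \<bar>G \<xi> $ \<mu>\<bar> \<le> \<bar>e\<bar> * \<bar>G \<xi> $ \<mu>\<bar>" using e by (intro mult_right_mono) auto
    moreover have "\<bar>e\<bar> * \<bar>G \<xi> $ \<mu>\<bar> < \<bar>e\<bar> * (\<sigma> * G \<xi> $ \<nu>)" using st e by (intro mult_strict_left_mono) auto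
    ultimately show ?thesis by linarith
  qed
  have increasing: "\<sigma> * \<phi> (Q d) < \<sigma> * \<phi> (Q e)" if de: "d < e" "\<bar>d\<bar> \<le> h" "\<bar>e\<bar> \<le> h" for d e
  proof -
    obtain \<xi> where \<xi>: "\<xi> \<in> closed_segment (Q d) (Q e)" "\<phi> (Q e) - \<phi> (Q d) = (Q e - Q d) \<bullet> G \<xi>"
      using gderiv_mvt[OF gderiv] by blast
    have "dist p \<xi> \<le> 2 * h"
      using segment_near[OF \<xi>(1)] Q_dist[of d] Q_dist[of e] de \<tau> h by simp
    then have "0 < \<sigma> * G \<xi> $ \<nu>" using steep_near by fastforce
    then have "0 < (e - d) * (\<sigma> * G \<xi> $ \<nu>)" using de by simp
    moreover have "\<phi> (Q e) - \<phi> (Q d) = (e - d) * G \<xi> $ \<nu>"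
      using \<xi>(2) inner_dirs[of "Q e - Q d" "G \<xi>" \<mu>] by (simp add: Q_nth flip: \<nu>_def)
    ultimately have "0 < \<sigma> * (\<phi> (Q e) - \<phi> (Q d))" by (simp add: mult.left_commute)
    then show ?thesis by (simp add: right_diff_distrib)
  qed
  \<comment> \<open>The signs at the offsets \<plusminus>|\<tau>| are opposite, which yields a zero
    strictly closer to g. For \<tau> = 0 the point p is g itself and e = 0.\<close>
  obtain e where e: "\<bar>e\<bar> \<le> \<bar>\<tau>\<bar>" "\<phi> (Q e) = 0" "\<tau> \<noteq> 0 \<Longrightarrow> \<bar>e\<bar> < \<bar>\<tau>\<bar>"
  proof (cases "\<tau> = 0")
    case True
    then have "Q 0 = p" using p_\<nu> vec_eq_dirs[of "Q 0" p \<mu>] by (simp add: Q_nth \<tau>_def flip: \<nu>_def)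
    then show thesis using that[of 0] p0 True by simp
  next
    case False
    have "continuous_on UNIV \<phi>"
      using gderiv unfolding gderiv_def
      by (meson has_derivative_continuous continuous_at_imp_continuous_on)
    then have "continuous_on {- \<bar>\<tau>\<bar>..\<bar>\<tau>\<bar>} (\<lambda>e. \<sigma> * \<phi> (Q e))"
    proof (intro continuous_on_mult continuous_on_const, rule continuous_on_compose2[of UNIV \<phi>])
      show "continuous_on {- \<bar>\<tau>\<bar>..\<bar>\<tau>\<bar>} Q" unfolding Q_def by (intro continuous_intros)
    qed auto
    moreover have ends: "\<sigma> * \<phi> (Q (- \<bar>\<tau>\<bar>)) < 0" "0 < \<sigma> * \<phi> (Q \<bar>\<tau>\<bar>)"
      using off[of "- \<bar>\<tau>\<bar>"] off[of "\<bar>\<tau>\<bar>"] \<tau> h False by auto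
    ultimately obtain e where e: "- \<bar>\<tau>\<bar> \<le> e" "e \<le> \<bar>\<tau>\<bar>" "\<sigma> * \<phi> (Q e) = 0"
      using IVT'[of "\<lambda>e. \<sigma> * \<phi> (Q e)" "- \<bar>\<tau>\<bar>" 0 "\<bar>\<tau>\<bar>"] by auto
    have "\<sigma> \<noteq> 0" using \<sigma>(1) by auto
    moreover have "e \<noteq> \<bar>\<tau>\<bar>" "e \<noteq> - \<bar>\<tau>\<bar>" using ends e(3) by auto
    ultimately show thesis using that[of e] e by auto
  qed
  have eh: "\<bar>e\<bar> \<le> h / 2" using e(1) \<tau> by simp
  have grid_Q: "Q 0 \<in> grid h" "Q h \<in> grid h" "Q (- h) \<in> grid h"
    using g grid_add_axis[OF g, of \<nu>] by (auto simp: Q_def)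
  have ins_iff: "ins x \<longleftrightarrow> \<phi> x < 0" if "x \<in> grid h" "\<phi> x \<noteq> 0" for x
    using labels that unfolding labeling_def by (cases "\<phi> x" "0::real" rule: linorder_cases) auto
  have opp: "ins (Q d) \<noteq> ins (Q d')"
    if "\<sigma> * \<phi> (Q d) < 0" "0 < \<sigma> * \<phi> (Q d')" "Q d \<in> grid h" "Q d' \<in> grid h" for d d'
  proof -
    have "\<sigma> = 1 \<or> \<sigma> = - 1" using \<sigma>(1) by auto
    then show ?thesis using ins_iff[OF that(3)] ins_iff[OF that(4)] that(1,2) by auto
  qed
  have ends: "\<sigma> * \<phi> (Q (- h)) < 0" "0 < \<sigma> * \<phi> (Q h)"
    using off[of "- h"] off[of h] \<tau> h by auto
  \<comment> \<open>If e = 0, the label of g is arbitrary, but the outer labels differ, so g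
    disagrees with one of them. Otherwise monotonicity along the line determines the sign at
    g.\<close>
  have "ins (Q 0) \<noteq> ins (Q h) \<and> 0 \<le> e \<or> ins (Q (- h)) \<noteq> ins (Q 0) \<and> e \<le> 0"
  proof (cases e "0::real" rule: linorder_cases)
    case less
    then show ?thesis using opp[OF ends(1) _ grid_Q(3,1)] increasing[of e 0] e(2) eh h by simp
  next
    case equal
    then show ?thesis using opp[OF ends grid_Q(3,2)] by auto
  next
    case greater
    then show ?thesis using opp[OF _ ends(2) grid_Q(1,2)] increasing[of 0 e] e(2) eh h by simp
  qed
  then have "\<exists>d. Q d \<in> grid h \<and> d \<le> e \<and> e \<le> d + h \<and> ins (Q d) \<noteq> ins (Q (d + h))"
  proof
    assume "ins (Q 0) \<noteq> ins (Q h) \<and> 0 \<le> e"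
    then show ?thesis using grid_Q(1) eh h by (intro exI[of _ 0]) simp
  next
    assume "ins (Q (- h)) \<noteq> ins (Q 0) \<and> e \<le> 0"
    then show ?thesis using grid_Q(3) eh h by (intro exI[of _ "- h"]) simp
  qed
  moreover have "Q e \<in> closed_segment (Q d) (Q d + h *\<^sub>R axis \<nu> 1)" if "d \<le> e" "e \<le> d + h" for d
    unfolding in_segment
  proof (intro exI[of _ "(e - d) / h"] conjI)
    show "Q e = (1 - (e - d) / h) *\<^sub>R Q d + ((e - d) / h) *\<^sub>R (Q d + h *\<^sub>R axis \<nu> 1)"
    proof -
      have "(1 - u) *\<^sub>R Q d + u *\<^sub>R (Q d + h *\<^sub>R axis \<nu> 1) = Q (d + u * h)" for u
        by (simp add: Q_def algebra_simps)
      then show ?thesis using h by simp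
    qed
  qed (use that h in auto)
  moreover have "Q d + h *\<^sub>R axis \<nu> 1 = Q (d + h)" for d by (simp add: Q_def algebra_simps)
  ultimately have "\<exists>g\<in>grid h. Q e \<in> closed_segment g (g + h *\<^sub>R axis \<nu> 1) \<and>
      ins g \<noteq> ins (g + h *\<^sub>R axis \<nu> 1)"
    by metis
  moreover have "\<eta> \<le> \<bar>unit_normal \<phi> (Q e) $ \<nu>\<bar>"
  proof -
    have "\<bar>G (Q e) $ \<mu>\<bar> < \<sigma> * G (Q e) $ \<nu>"
      using steep_near[of "Q e"] Q_dist[of e] eh \<tau> h by simp
    also have "\<dots> \<le> \<bar>G (Q e) $ \<nu>\<bar>" using \<sigma>(1) by (metis abs_ge_self abs_mult mult_1)
    finally have "(G (Q e) $ \<mu>)\<^sup>2 \<le> (G (Q e) $ \<nu>)\<^sup>2"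
      by (intro abs_le_square_iff[THEN iffD1]) simp
    then have "(norm (G (Q e)))\<^sup>2 \<le> (sqrt 2 * \<bar>G (Q e) $ \<nu>\<bar>)\<^sup>2"
      by (simp add: norm_sq_dirs[of _ \<mu>] power_mult_distrib flip: \<nu>_def)
    then have "norm (G (Q e)) \<le> sqrt 2 * \<bar>G (Q e) $ \<nu>\<bar>" by (rule power2_le_imp_le) simp
    moreover have "norm (G (Q e)) > 0" using lower[OF e(2)] c0_pos by linarith
    ultimately have "1 / sqrt 2 \<le> \<bar>unit_normal \<phi> (Q e) $ \<nu>\<bar>"
      by (simp add: unit_normal_nth abs_divide field_simps)
    then show ?thesis using \<eta> by simp
  qed
  ultimately have cut: "Q e \<in> cuts_in_dir \<phi> \<eta> h ins \<nu>"
    using e(2) by (simp add: cuts_in_dir_def)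
  \<comment> \<open>If \<tau> = 0, p is a cut point in both directions, and \<open>dir\<close>
    prefers the larger normal component. Otherwise \<open>Q e\<close> competes with p for the grid
    point g and is strictly closer.\<close>
  show False
  proof (cases "\<tau> = 0")
    case True
    then have "Q e = p" using e(1) p_\<nu> vec_eq_dirs[of "Q e" p \<mu>] by (simp add: Q_nth \<tau>_def flip: \<nu>_def)
    then have "\<bar>unit_normal \<phi> p $ \<nu>\<bar> \<le> \<bar>unit_normal \<phi> p $ \<mu>\<bar>"
      using dir p_props(1) cut \<mu> by auto
    moreover have "norm (G p) > 0" using lower[OF p0] c0_pos by linarith
    ultimately have "\<bar>G p $ \<nu>\<bar> \<le> \<bar>G p $ \<mu>\<bar>"
      by (simp add: unit_normal_nth abs_divide divide_le_cancel)
    then show False using steep mult_pos_pos[OF M_pos h] by simp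
  next
    case False
    have Q_cut: "Q e \<in> cuts \<phi> \<eta> h ins" using cut by (auto simp: cuts_def)
    then have near_grid: "near (Q e) \<in> grid h" using near by blast
    note nQ = cut_near[OF cut]
    \<comment> \<open>The strict bound |e| < |\<tau>| \<le> h / 2 rules out a tie with the next grid
      point.\<close>
    have "\<bar>g $ \<nu> - near (Q e) $ \<nu>\<bar> < h"
      using nQ(1)[unfolded Q_nth] e(3)[OF False] \<tau> by linarith
    then have "g $ \<nu> = near (Q e) $ \<nu>" using grid_nth_eq[OF g near_grid] by blast
    moreover have "g $ \<mu> = near (Q e) $ \<mu>" using nQ(2) by (simp add: Q_nth \<nu>_def)
    ultimately have "near (Q e) = g" using vec_eq_dirs[of _ g \<mu>] by (simp flip: \<nu>_def)
    then have "dist (prim g) g \<le> dist (Q e) g" using prim Q_cut p_props(1) by (auto simp: g_def)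
    then have "dist p g \<le> \<bar>e\<bar>" using p_props(2) by (simp add: g_def Q_def dist_norm)
    moreover have "\<bar>\<tau>\<bar> \<le> dist p g"
      using component_le_norm_cart[of "p - g" \<mu>] by (simp add: \<tau>_def dist_norm)
    ultimately show False using e(3)[OF False] by simp
  qed
qed

text \<open>The squared gradient components add up to N^2, and by \<open>primary_slope\<close> they
  differ by at most 2 d N in the unfavorable direction.\<close>

lemma primary_normal_bound:
  assumes p: "p \<in> set ps"
  shows "1 / 2 - 4 * M * h / c0 \<le> (unit_normal \<phi> p $ dir p)\<^sup>2"
proof -
  define a where "a = \<bar>G p $ dir p\<bar>"
  define b where "b = \<bar>G p $ other_dir (dir p)\<bar>"
  define N where "N = norm (G p)"
  define d where "d = 4 * M * h"
  have "\<phi> p = 0" using cut_zero primary_props(1)[OF p] .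
  then have N: "c0 \<le> N" "N > 0" using lower[of p] c0_pos by (auto simp: N_def)
  have d: "d \<ge> 0" using M_pos h by (simp add: d_def)
  have ab: "a \<le> N" "b \<le> N" "0 \<le> a" "0 \<le> b" unfolding a_def b_def N_def
    using component_le_norm_cart by auto
  have "b \<le> a + d" using primary_slope[OF p refl] by (simp add: a_def b_def d_def)
  then have "(b - a) * (b + a) \<le> d * (N + N)"
    using ab d by (intro mult_mono) auto
  moreover have N2: "N\<^sup>2 = a\<^sup>2 + b\<^sup>2"
    unfolding N_def a_def b_def using norm_sq_dirs[of "G p" "dir p"] by simp
  ultimately have "N\<^sup>2 / 2 - d * N \<le> a\<^sup>2" by (simp add: power2_eq_square algebra_simps)
  then have "(N\<^sup>2 / 2 - d * N) / N\<^sup>2 \<le> a\<^sup>2 / N\<^sup>2" by (rule divide_right_mono) simp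
  then have "1 / 2 - d / N \<le> a\<^sup>2 / N\<^sup>2"
    using N by (simp add: diff_divide_distrib power2_eq_square)
  moreover have "d / N \<le> d / c0" using N d c0_pos by (intro divide_left_mono) auto
  moreover have "a\<^sup>2 / N\<^sup>2 = (unit_normal \<phi> p $ dir p)\<^sup>2"
    by (simp add: unit_normal_nth a_def N_def power_divide)
  ultimately show ?thesis by (simp add: d_def)
qed

text \<open>With C the normal component at p, \<open>c_nbr p e\<close> is C^2 plus C times half the
  change of c over one step. B h bounds that change, and C \<le> 1.\<close>

lemma coefficient_bounds:
  assumes p: "p \<in> set ps" and \<sigma>: "\<bar>\<sigma>\<bar> = 1"
  defines "B \<equiv> 2 * M * box_ratio \<eta> / c0"
  shows "1 / 2 - 2 * B * h \<le> c_nbr p \<sigma>" "c_nbr p \<sigma> \<le> c_nbr p (- \<sigma>) + B * h"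
proof -
  note p_props = primary_props[OF p]
  have p0: "\<phi> p = 0" using cut_zero p_props(1) .
  then have "norm (G p) > 0" using lower[of p] c0_pos by linarith
  then have \<eta>p: "\<eta> * norm (G p) \<le> \<bar>G p $ dir p\<bar>"
    using p_props(3) by (simp add: cuts_in_dir_def unit_normal_nth abs_divide field_simps)
  have "1 / sqrt 2 \<le> 1" by simp
  then have "\<eta> \<le> 1" using \<eta> by linarith
  note graph = local_graph_props[OF p0 \<eta>p \<eta>(1) this h small(2,3), folded graph_fun_def]
  define C where "C = c_fun p (param p)"
  have C: "C = \<bar>unit_normal \<phi> p $ dir p\<bar>"
    using graph(2)[of "param p"] graph(1) h by (simp add: C_def c_fun_def param_def)
  have C1: "0 \<le> C" "C \<le> 1"
    unfolding C unit_normal_nth using component_le_norm_cart[of "G p" "dir p"] \<open>norm (G p) > 0\<close>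
    by (auto simp: abs_divide)
  have lip: "\<bar>c_fun p (param p + e * h) - C\<bar> \<le> B * h" if e: "\<bar>e\<bar> = 1" for e
  proof -
    define P where "P = graph_point (dir p) (graph_fun p) (param p + e * h)"
    have "\<bar>e * h\<bar> < 2 * h" using e h by (simp add: abs_mult)
    then have P: "\<phi> P = 0" "dist p P \<le> box_ratio \<eta> * h" "c_fun p (param p + e * h) = \<bar>unit_normal \<phi> P $ dir p\<bar>"
      using graph(2)[of "param p + e * h"] by (auto simp: P_def c_fun_def param_def)
    then have "\<bar>c_fun p (param p + e * h) - C\<bar> \<le> 2 * M * dist p P / c0"
      using unit_normal_diff[OF p0 P(1)] small(2) by (simp add: C)
    also have "\<dots> \<le> 2 * M * (box_ratio \<eta> * h) / c0"
      using P(2) M_pos c0_pos by (intro divide_right_mono mult_left_mono) auto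
    finally show ?thesis by (simp add: B_def)
  qed
  have c_nbr: "c_nbr p e = C\<^sup>2 + C * ((c_fun p (param p + e * h) - C) / 2)" for e
    by (simp add: c_nbr_def C_def power2_eq_square field_simps)
  \<comment> \<open>Since \<open>box_ratio \<eta>\<close> is at least 2, B also absorbs the error of
    \<open>primary_normal_bound\<close>.\<close>
  have B: "B \<ge> 4 * M / c0"
  proof -
    have "M * 2 \<le> M * box_ratio \<eta>" using M_pos \<eta> by (simp add: box_ratio_def)
    then show ?thesis unfolding B_def using c0_pos by (simp add: divide_right_mono)
  qed
  then have "4 * M / c0 * h \<le> B * h" using h by (intro mult_right_mono) auto
  then have "1 / 2 - B * h \<le> C\<^sup>2" using primary_normal_bound[OF p] by (simp add: C)
  moreover have Bh: "0 \<le> B * h" using B h M_pos c0_pos by (smt (verit) divide_pos_pos mult_nonneg_nonneg)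
  have dev: "\<bar>C * ((c_fun p (param p + e * h) - C) / 2)\<bar> \<le> B * h / 2" if "\<bar>e\<bar> = 1" for e
  proof -
    have "\<bar>C * ((c_fun p (param p + e * h) - C) / 2)\<bar> \<le> 1 * (B * h / 2)"
      unfolding abs_mult using lip[OF that] C1 by (intro mult_mono) auto
    then show ?thesis by simp
  qed
  ultimately show "1 / 2 - 2 * B * h \<le> c_nbr p \<sigma>"
    using dev[OF \<sigma>] unfolding c_nbr by linarith
  have "\<bar>- \<sigma>\<bar> = 1" using \<sigma> by simp
  then show "c_nbr p \<sigma> \<le> c_nbr p (- \<sigma>) + B * h"
    using dev[OF \<sigma>] dev[of "- \<sigma>"] unfolding c_nbr by linarith
qed

text \<open>With b = B h, the bounds c+ \<le> c- + b and c- \<ge> 1/2 - 2 b reduce the required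
  ratio to h^2 / k \<le> 2 - 9 b. The condition on k implies this because (1/2 + 9 b) (2 - 9 b)
  \<ge> 1 for 18 b \<le> 1.\<close>

lemma inverse_nonneg:
  defines "B \<equiv> 2 * M * box_ratio \<eta> / c0"
  assumes k: "k > 0" "k / h\<^sup>2 \<ge> 1 / 2 + 9 * B * h" and hB: "18 * B * h \<le> 1"
  defines "A \<equiv> 1\<^sub>m (length ps) - k \<cdot>\<^sub>m Lap_red"
  shows "invertible_mat A" "\<forall>i<length ps. \<forall>j<length ps. mat_inv A $$ (i, j) \<ge> 0"
proof -
  have B: "B > 0" using M_pos c0_pos \<eta> by (simp add: B_def box_ratio_def add_pos_pos)
  define b where "b = B * h"
  have b: "b > 0" "18 * b \<le> 1" using B h hB by (auto simp: b_def)
  have "(1 / 2 + 9 * b) * (2 - 9 * b) - 1 = b * (27 - 162 * b) / 2"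
    by (simp add: algebra_simps)
  also have "\<dots> \<ge> 0" using b by simp
  finally have "1 \<le> (1 / 2 + 9 * b) * (2 - 9 * b)" by simp
  also have "\<dots> \<le> k / h\<^sup>2 * (2 - 9 * b)" using k b by (intro mult_right_mono) (auto simp: b_def)
  finally have hk: "h\<^sup>2 / k \<le> 2 - 9 * b" using k h by (simp add: field_simps)
  have pos: "c_nbr p \<sigma> > 0" if "p \<in> set ps" "\<bar>\<sigma>\<bar> = 1" for p \<sigma>
    using coefficient_bounds(1)[OF that] b by (simp add: b_def B_def)
  have ratio: "h\<^sup>2 / k + c_nbr p \<sigma> \<le> 5 * c_nbr p (- \<sigma>)" if "p \<in> set ps" "\<bar>\<sigma>\<bar> = 1" for p \<sigma>
    using coefficient_bounds(1)[of p "- \<sigma>", folded B_def] coefficient_bounds(2)[OF that, folded B_def] hk that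
    by (simp add: b_def mult.assoc)
  show "invertible_mat A" "\<forall>i<length ps. \<forall>j<length ps. mat_inv A $$ (i, j) \<ge> 0"
    unfolding A_def using reduced_operator_inverse_nonneg[OF k(1) h _ pos ratio] theta_bound by auto
qed

end

section \<open>Uniform constants of the curve and the choice of the grid size\<close>

lemma closed_C2_curve_bounded:
  assumes "closed_C2_curve S"
  shows "bounded S"
proof -
  obtain X X' :: "real \<Rightarrow> real^2" where X: "\<And>t. (X has_vector_derivative X' t) (at t)"
    "\<And>t. X (t + 1) = X t" "S = range X"
    using assms unfolding closed_C2_curve_def by blast
  have int: "X (t + of_int i) = X t" for t i
  proof (induction i rule: int_induct[of _ 0])
    case (step1 i)
    then show ?case using X(2)[of "t + of_int i"] by (simp add: add.assoc)
  next
    case (step2 i)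
    then show ?case using X(2)[of "t + of_int (i - 1)"] by (simp add: algebra_simps)
  qed simp
  have "X t \<in> X ` {0..1}" for t
  proof -
    have "X t = X (frac t)" using int[of "frac t" "\<lfloor>t\<rfloor>"] by (simp add: frac_def)
    moreover have "frac t \<in> {0..1}" by (simp add: frac_ge_0 frac_lt_1 less_imp_le)
    ultimately show ?thesis by blast
  qed
  then have "S \<subseteq> X ` {0..1}" using X(3) by auto
  moreover have "compact (X ` {0..1})"
    using X(1) by (intro compact_continuous_image continuous_at_imp_continuous_on)
      (auto intro: has_vector_derivative_continuous)
  ultimately show ?thesis using compact_imp_bounded bounded_subset by blast
qed

text \<open>The ball of radius R + 1 contains every unit ball around a zero of \<phi>. The second
  derivatives are bounded on it by compactness, which gives the Lipschitz constant.\<close>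

lemma regular_curve_exists:
  assumes C2: "C2_function \<phi>" and bdd: "bounded {p. \<phi> p = 0}"
    and c0: "c0 > 0" "\<forall>p. \<phi> p = 0 \<longrightarrow> norm (grad \<phi> p) \<ge> c0"
  obtains G M where "regular_curve \<phi> G M c0"
proof -
  obtain G H where G: "\<And>x. GDERIV \<phi> x :> G x" "\<And>x. (G has_derivative (\<lambda>v. H x *v v)) (at x)"
    and H: "continuous_on UNIV (H :: real^2 \<Rightarrow> real^2^2)"
    using C2 unfolding C2_function_def by blast
  obtain R where R: "\<And>p. \<phi> p = 0 \<Longrightarrow> norm p \<le> R" using bdd by (auto simp: bounded_iff)
  define D where "D = cball (0 :: real^2) (R + 1)"
  have "bounded (H ` D)" unfolding D_def
    by (intro compact_imp_bounded compact_continuous_image continuous_on_subset[OF H]) auto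
  then obtain b where b: "\<And>x. x \<in> D \<Longrightarrow> norm (H x) \<le> b" by (auto simp: bounded_iff)
  \<comment> \<open>The factor 4 counts the entries of the 2 by 2 Hessian matrix.\<close>
  have onorm: "onorm ((*v) (H x)) \<le> 4 * b" if x: "x \<in> D" for x
  proof -
    have "\<bar>H x $ i $ j\<bar> \<le> b" for i j
      using component_le_norm_cart[of "H x $ i" j] Finite_Cartesian_Product.norm_nth_le[of "H x" i] b[OF x] by linarith
    from onorm_le_matrix_component[OF this] show ?thesis by simp
  qed
  define M where "M = max 1 (4 * b)"
  have "regular_curve \<phi> G M c0"
  proof
    show "isCont G x" for x using G(2) has_derivative_continuous by blast
    show "c0 \<le> norm (G p)" if "\<phi> p = 0" for p
      using c0(2) that grad_eq[OF G(1)[of p]] by auto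
    fix p x y assume p: "\<phi> p = 0" "dist p x \<le> 1" "dist p y \<le> 1"
    have "x \<in> D" "y \<in> D"
      using R[OF p(1)] p(2,3) norm_triangle_sub[of x p] norm_triangle_sub[of y p]
      by (auto simp: D_def dist_norm norm_minus_commute)
    then have "norm (G x - G y) \<le> 4 * b * norm (x - y)"
      by (intro differentiable_bound[where S = D and f' = "\<lambda>x v. H x *v v"] onorm)
        (auto simp: D_def intro: has_derivative_at_withinI G(2))
    also have "\<dots> \<le> M * dist x y" unfolding M_def dist_norm by (intro mult_right_mono) auto
    finally show "norm (G x - G y) \<le> M * dist x y" .
  qed (use G c0 in \<open>auto simp: M_def\<close>)
  then show thesis by (rule that)
qed

theorem lemmaA1:
  fixes \<phi> :: "real^2 \<Rightarrow> real" and c0 \<eta> :: real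
  assumes "C2_function \<phi>"
    and "closed_C2_curve {p. \<phi> p = 0}"
    and "c0 > 0" and "\<forall>p. \<phi> p = 0 \<longrightarrow> norm (grad \<phi> p) \<ge> c0"
    and "0 < \<eta>" and "\<eta> < 1 / sqrt 2"
  shows "\<exists>K h0 :: real. h0 > 0 \<and>
    (\<forall>h k ins dir near prim ps ss.
       0 < h \<and> h \<le> h0 \<and> 0 < k \<and> k / h\<^sup>2 \<ge> 1 / 2 + K * h \<and>
       cut_points \<phi> \<eta> h ins dir near prim ps ss \<longrightarrow>
       (let n = length ps;
            A = 1\<^sub>m n - k \<cdot>\<^sub>m cut_points.Lap_red \<phi> h dir near prim ps ss
        in invertible_mat A \<and> (\<forall>i<n. \<forall>j<n. mat_inv A $$ (i, j) \<ge> 0)))"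
proof -
  obtain G M where curve: "regular_curve \<phi> G M c0"
    using regular_curve_exists closed_C2_curve_bounded assms by metis
  then interpret regular_curve \<phi> G M c0 .
  define r where "r = box_ratio \<eta>"
  have r: "r > 0" using assms(5) by (simp add: r_def box_ratio_def add_pos_pos)
  define B where "B = 2 * M * r / c0"
  have B: "B > 0" using r M_pos c0_pos by (simp add: B_def)
  \<comment> \<open>In order, the four bounds put the 2 h-ball and the box inside the unit ball,
    limit the variation of the gradient over the box, and ensure 18 B h \<le> 1.\<close>
  define h0 where "h0 = Min {1 / 2, 1 / r, \<eta> * c0 / (2 * M * r), 1 / (18 * B)}"
  have "h0 > 0" using r M_pos c0_pos B assms(5) by (simp add: h0_def)
  moreover have "invertible_mat (1\<^sub>m (length ps) - k \<cdot>\<^sub>m cut_points.Lap_red \<phi> h dir near prim ps ss) \<and>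
      (\<forall>i<length ps. \<forall>j<length ps.
         mat_inv (1\<^sub>m (length ps) - k \<cdot>\<^sub>m cut_points.Lap_red \<phi> h dir near prim ps ss) $$ (i, j) \<ge> 0)"
    if *: "0 < h" "h \<le> h0" "0 < k" "k / h\<^sup>2 \<ge> 1 / 2 + 9 * B * h"
      "cut_points \<phi> \<eta> h ins dir near prim ps ss" for h k ins dir near prim ps ss
  proof -
    have hb: "h \<le> 1 / 2" "h \<le> 1 / r" "h \<le> \<eta> * c0 / (2 * M * r)" "h \<le> 1 / (18 * B)"
      using *(2) by (auto simp: h0_def)
    interpret regular_cut_points \<phi> G M c0 \<eta> h ins dir near prim ps ss
    proof (intro regular_cut_points.intro curve *(5) regular_cut_points_axioms.intro)
      show "box_ratio \<eta> * h \<le> 1" using hb(2) r by (simp add: field_simps r_def)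
      show "M * (box_ratio \<eta> * h) \<le> \<eta> * c0 / 2"
        using hb(3) r M_pos by (simp add: field_simps r_def)
    qed (use hb * assms in auto)
    have hB: "18 * B * h \<le> 1" using hb(4) B by (simp add: field_simps)
    show ?thesis
      using inverse_nonneg[of k, folded r_def, folded B_def] *(3,4) hB by blast
  qed
  ultimately show ?thesis unfolding Let_def by blast
qed

end
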